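(* There exists $\beta_\infty>0$ such that the following holds. Let $w_0:[0,\infty)\to[0,\infty)$ be a decreasing integrable function with $\int_0^\infty w_0(x)\,dx=1$, which is initial data for the LSW system and satisfies $L(0)=1$. Let $X_0$ be the random variable associated with $w_0$ and $\beta_0(\cdot)$ its beta function, and suppose $\sup\beta_0(\cdot)\le\beta_\infty$ and $\liminf_{x\to\|X_0\|_\infty}\beta_0(x)>0$. Let $w(x,t)$, $x\ge0$, $t\ge0$, be the solution of the LSW system with initial data $w_0$. Then there is a constant $C>0$, depending only on the function $\beta_0(\cdot)$, such that $$\Lambda(T)\ge CT,\qquad T\ge1 .$$
   Context: Beta function. For a nonnegative decreasing integrable function $w$ on $[0,\infty)$ (not identically zero) let $X$ be the associated positive random variable, with $P(X>x)=w(x)/w(0)$, let $\|X\|_\infty\in(0,\infty]$ be its essential supremum, and let $h(x)=\int_x^\infty w(x')\,dx'$. Assuming $h$ is $C^2$ on $[0,\|X\|_\infty)$, the beta function of $w$ (or of $X$) is $\beta(x)=h''(x)h(x)/h'(x)^2$, $0\le x<\|X\|_\infty$. Beta functions are assumed to exist in this sense whenever mentioned. LSW system. It consists of $$\frac{\partial w(x,t)}{\partial t}=\left[1-\left\{\frac{x}{L(t)}\right\}^{1/3}\right]\frac{\partial w}{\partial x}(x,t),\quad x>0,\ t>0,\qquad \int_0^\infty w(x,t)\,dx=1,$$ with $w(x,0)=w_0(x)$; the function $L(t)>0$ is determined by the integral constraint and is given by $L(t)^{1/3}=\frac13\int_0^\infty x^{-2/3}w(x,t)\,dx\,/\,w(0,t)$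 (also at $t=0$ with $w(\cdot,0)=w_0$). Solutions are understood via characteristics: $L$ is continuous and positive and $w(x,t)=w_0(F(x,t))$, where $F(x,t)=x(0)$ and $x(s)$, $0\le s\le t$, solves $dx/ds=-[1-\{x/L(s)\}^{1/3}]$, $x(t)=x$. With $c(\cdot,t)=-\partial w(\cdot,t)/\partial x$, the mean cluster volume is $\Lambda(t)=\int_0^\infty x\,c(x,t)\,dx\big/\int_0^\infty c(x,t)\,dx=1/w(0,t)$. *)

theory Defs
  imports "HOL-Probability.Probability"
begin

text \<open>
  Functions on \<open>[0,\<infinity>)\<close> are rendered as total functions on the reals; every definition
  looks only at their values on \<open>[0,\<infinity>)\<close>.
\<close>

definition tail_integral :: "(real \<Rightarrow> real) \<Rightarrow> real \<Rightarrow> real" where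
  "tail_integral w x = (LBINT y:{x..}. w y)"

text \<open>The random variable associated with \<open>w\<close> is represented by its law \<open>P\<close> on the real line.\<close>

definition associated_law :: "(real \<Rightarrow> real) \<Rightarrow> real measure \<Rightarrow> bool" where
  "associated_law w P \<longleftrightarrow>
     real_distribution P \<and> (\<forall>x\<ge>0. measure P {x<..} = w x / w 0)"

definition Linf_norm :: "real measure \<Rightarrow> ereal" where
  "Linf_norm P = esssup P (\<lambda>x. ereal \<bar>x\<bar>)"

text \<open>
  \<open>is_beta_function w M b\<close>: the function \<open>h = tail_integral w\<close> is \<open>C\<^sup>2\<close> on \<open>[0,M)\<close>, with
  one-sided derivatives at \<open>0\<close>, and \<open>b = h'' h / h'\<^sup>2\<close> there.  The values of \<open>b\<close>
  outside \<open>[0,M)\<close> are irrelevant.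
\<close>

definition beta_domain :: "ereal \<Rightarrow> real set" where
  "beta_domain M = {x. 0 \<le> x \<and> ereal x < M}"

definition is_beta_function :: "(real \<Rightarrow> real) \<Rightarrow> ereal \<Rightarrow> (real \<Rightarrow> real) \<Rightarrow> bool" where
  "is_beta_function w M b \<longleftrightarrow>
     (\<exists>h1 h2.
        (\<forall>x\<in>beta_domain M.
            (tail_integral w has_real_derivative h1 x) (at x within beta_domain M)) \<and>
        (\<forall>x\<in>beta_domain M. (h1 has_real_derivative h2 x) (at x within beta_domain M)) \<and>
        continuous_on (beta_domain M) h2 \<and>
        (\<forall>x\<in>beta_domain M. b x = h2 x * tail_integral w x / (h1 x)\<^sup>2))"

definition lsw_initial_data :: "(real \<Rightarrow> real) \<Rightarrow> bool" where
  "lsw_initial_data w0 \<longleftrightarrow>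
     (\<forall>x\<ge>0. 0 \<le> w0 x) \<and>
     antimono_on {0..} w0 \<and>
     set_integrable lborel {0..} w0 \<and>
     (LBINT x:{0..}. w0 x) = 1"

text \<open>
  \<open>\<xi>\<close> is the characteristic on \<open>[0,t]\<close> that passes through \<open>x\<close> at time \<open>t\<close>, so that
  \<open>\<xi> 0 = F(x,t)\<close>.  For \<open>t = 0\<close> the derivative condition is void and \<open>\<xi> 0 = x\<close>.
\<close>

definition lsw_characteristic ::
    "(real \<Rightarrow> real) \<Rightarrow> real \<Rightarrow> real \<Rightarrow> (real \<Rightarrow> real) \<Rightarrow> bool" where
  "lsw_characteristic L t x \<xi> \<longleftrightarrow>
     (\<forall>s\<in>{0..t}. 0 \<le> \<xi> s \<and>
        (\<xi> has_real_derivative - (1 - root 3 (\<xi> s / L s))) (at s within {0..t})) \<and>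
     \<xi> t = x"

text \<open>\<open>w x t\<close> stands for \<open>w(x,t)\<close>.\<close>

definition lsw_solution ::
    "(real \<Rightarrow> real) \<Rightarrow> (real \<Rightarrow> real \<Rightarrow> real) \<Rightarrow> (real \<Rightarrow> real) \<Rightarrow> bool" where
  "lsw_solution w0 w L \<longleftrightarrow>
     continuous_on {0..} L \<and> (\<forall>t\<ge>0. 0 < L t) \<and>
     (\<forall>x\<ge>0. w x 0 = w0 x) \<and>
     (\<forall>x\<ge>0. \<forall>t\<ge>0. \<exists>\<xi>. lsw_characteristic L t x \<xi> \<and> w x t = w0 (\<xi> 0)) \<and>
     (\<forall>t\<ge>0. set_integrable lborel {0..} (\<lambda>x. w x t) \<and> (LBINT x:{0..}. w x t) = 1) \<and>
     (\<forall>t\<ge>0. root 3 (L t) = (1/3) * (LBINT x:{0..}. x powr (-2/3) * w x t) / w 0 t)"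

definition cluster_density :: "(real \<Rightarrow> real \<Rightarrow> real) \<Rightarrow> real \<Rightarrow> real \<Rightarrow> real" where
  "cluster_density w x t = - deriv (\<lambda>y. w y t) x"

definition mean_cluster_volume :: "(real \<Rightarrow> real \<Rightarrow> real) \<Rightarrow> real \<Rightarrow> real" where
  "mean_cluster_volume w t =
     (LBINT x:{0<..}. x * cluster_density w x t) / (LBINT x:{0<..}. cluster_density w x t)"

end

theory Submission
  imports Defs
begin

text \<open>
  The proof follows the volume \<open>X(t)\<close> of the largest cluster, which starts at \<open>R = \<parallel>X\<^sub>0\<parallel>\<^sub>\<infinity>\<close> and
  solves \<open>X' = (X / L)\<^bsup>1/3\<^esup> - 1\<close>, where \<open>L\<^bsup>1/3\<^esup>\<close> is the mean of the cube roots of the volumes at time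
  \<open>t\<close>.  In particular \<open>L \<le> X\<close>.

  Write \<open>h\<close> for the tail integral of \<open>w\<^sub>0\<close>.  Since \<open>(h / w\<^sub>0)' = \<beta>\<^sub>0 - 1\<close>, the bound
  \<open>\<beta>\<^sub>0 \<le> 1 / 33\<close> makes \<open>R\<close> finite and forces \<open>w\<^sub>0(y) / w\<^sub>0(x)\<close> to be at least the power \<open>1 / 32\<close> of
  \<open>(R - y) / (R - x)\<close> for \<open>x \<le> y\<close>; and \<open>\<delta> \<le> \<beta>\<^sub>0\<close> on \<open>[x\<^sub>0, R)\<close> makes it at most the power \<open>\<delta>\<close>
  there (\<open>initial_data_logarithmic_derivative\<close>).  As \<open>w\<close> is constant along characteristics, such
  bounds carry over to later times once it is known how the flow distorts ratios of gaps to the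
  largest cluster.

  By concavity of the cube root, the ratio of a smaller gap to a larger one only decreases with time
  (\<open>gap_ratio_antimono\<close>).  Hence
  the profile \<open>w(_,t)\<close> inherits the lower bound and the volumes are concentrated near \<open>X\<close>; the
  outcome is \<open>X / L \<le> (7 / 6)\<^sup>3\<close>, so that \<open>X' \<le> 1 / 6\<close>, and \<open>X / 2 \<le> 1 / w(0,t)\<close>.  A gap to
  the largest cluster, on the other hand, grows at relative rate at least \<open>1 / (3 X)\<close>, twice the
  relative rate of \<open>X\<close> (\<open>gap_fraction_deriv\<close>).  This has two consequences.  Every initial volume below
  \<open>R\<close> is used up by an explicit time (\<open>dissolution_time_le\<close>).  And since chord slopes of the cube
  root to the point \<open>X\<close> differ by at most a multiple of the larger gap, these ratios decrease by no more than
  a factor \<open>exp 21\<close> over all times (\<open>gap_ratio_le\<close>).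

  So after the initial volumes below \<open>x\<^sub>0\<close> are used up, the upper bound for \<open>w\<^sub>0\<close> shows that a fixed
  fraction of the clusters has volume less than a fixed multiple, below \<open>1\<close>, of \<open>X\<close>.  Therefore
  \<open>L / X\<close> is bounded away from \<open>1\<close> (\<open>root3_L_le_critical\<close>) and \<open>X\<close> grows at least linearly.  It
  remains to identify \<open>\<Lambda>(T)\<close> with \<open>1 / w(0,T)\<close> (\<open>mean_cluster_volume_eq\<close>).  This uses
  that the characteristics depend differentiably on their ends, so that \<open>w(_,T)\<close> is the
  integral of its derivative.
\<close>

section \<open>Initial data in terms of the beta function\<close>

lemma initial_data_at_zero_pos:
  assumes "lsw_initial_data u"
  shows "0 < u 0"
proof (rule ccontr)
  assume "\<not> 0 < u 0"
  have nonneg: "0 \<le> u x" and anti: "u x \<le> u 0" if "0 \<le> x" for x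
    using assms that by (auto simp: lsw_initial_data_def monotone_on_def)
  have "u x = 0" if "0 \<le> x" for x
    using nonneg[OF that] anti[OF that] \<open>\<not> 0 < u 0\<close> by linarith
  then have "(LBINT x:{0..}. u x) = (LBINT x:{0::real..}. 0)"
    by (intro set_lebesgue_integral_cong) auto
  then show False
    using assms by (simp add: lsw_initial_data_def set_lebesgue_integral_def)
qed

text \<open>The essential supremum of the law is the right end of the support of \<open>u\<close>.\<close>

lemma support_of_initial_data:
  assumes u: "lsw_initial_data u" and P: "associated_law u P" and "0 \<le> x"
  shows "ereal x < Linf_norm P \<Longrightarrow> 0 < u x" and "Linf_norm P \<le> ereal x \<Longrightarrow> u x = 0"
proof -
  interpret real_distribution P
    using P by (simp add: associated_law_def)
  have pos: "0 < u 0"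
    by (rule initial_data_at_zero_pos[OF u])
  have tail: "measure P {y<..} = u y / u 0" if "0 \<le> y" for y
    using P that by (simp add: associated_law_def)
  have null_iff: "measure P {y<..} = 0 \<longleftrightarrow> (AE z in P. z \<le> y)" for y
    by (subst prob_eq_0) (auto simp: not_less)
  show "u x = 0" if "Linf_norm P \<le> ereal x"
  proof -
    have "AE z in P. ereal \<bar>z\<bar> \<le> Linf_norm P"
      unfolding Linf_norm_def by (rule esssup_AE)
    then have "AE z in P. z \<le> x"
      by eventually_elim (use that in \<open>auto dest: order_trans\<close>)
    then show ?thesis
      using null_iff[of x] tail[OF \<open>0 \<le> x\<close>] pos by simp
  qed
  show "0 < u x" if "ereal x < Linf_norm P"
  proof (rule ccontr)
    assume "\<not> 0 < u x"
    then have "u x = 0"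
      using u \<open>0 \<le> x\<close> by (force simp: lsw_initial_data_def)
    then have "AE z in P. z \<le> x"
      using null_iff[of x] tail[OF \<open>0 \<le> x\<close>] by simp
    moreover have "AE z in P. z \<in> {0<..}"
      by (rule AE_prob_1) (use tail[of 0] pos in simp)
    ultimately have "AE z in P. ereal \<bar>z\<bar> \<le> ereal x"
      by eventually_elim auto
    then have "Linf_norm P \<le> ereal x"
      unfolding Linf_norm_def by (intro esssup_I) auto
    with that show False by simp
  qed
qed

text \<open>Right-continuity is inherited from the distribution function of the law.\<close>

lemma initial_data_right_continuous:
  assumes u: "lsw_initial_data u" and P: "associated_law u P" and "0 \<le> x"
  shows "(u \<longlongrightarrow> u x) (at_right x)"
proof -
  interpret real_distribution P
    using P by (simp add: associated_law_def)
  have tail: "measure P {y<..} = u y / u 0" if "0 \<le> y" for y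
    using P that by (simp add: associated_law_def)
  have eq: "u y = u 0 * (1 - cdf P y)" if "0 \<le> y" for y
  proof -
    have "{y<..} = space P - {..y}" by auto
    then have "measure P {y<..} = 1 - cdf P y"
      using prob_compl[of "{..y}"] by (simp add: cdf_def)
    then show ?thesis
      using tail[OF that] initial_data_at_zero_pos[OF u] by (simp add: field_simps)
  qed
  have "(cdf P \<longlongrightarrow> cdf P x) (at_right x)"
    using cdf_is_right_cont by (simp add: continuous_within)
  then have "((\<lambda>y. u 0 * (1 - cdf P y)) \<longlongrightarrow> u 0 * (1 - cdf P x)) (at_right x)"
    by (intro tendsto_intros)
  moreover have "\<forall>\<^sub>F y in at_right x. u 0 * (1 - cdf P y) = u y"
    unfolding eventually_at_filter
    by (intro always_eventually allI impI eq[symmetric]) (use \<open>0 \<le> x\<close> in simp)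
  ultimately show ?thesis
    unfolding eq[OF \<open>0 \<le> x\<close>] by (rule Lim_transform_eventually)
qed

lemma tail_integral_increment:
  assumes u: "lsw_initial_data u" and "0 \<le> x" "x \<le> y"
  shows "u y * (y - x) \<le> tail_integral u x - tail_integral u y"
    and "tail_integral u x - tail_integral u y \<le> u x * (y - x)"
proof -
  have anti: "u b \<le> u a" if "0 \<le> a" "a \<le> b" for a b
    using u that by (auto simp: lsw_initial_data_def monotone_on_def)
  have int0: "set_integrable lborel {0..} u"
    using u by (simp add: lsw_initial_data_def)
  have int: "set_integrable lborel {y..} u" "set_integrable lborel {x..<y} u"
    using assms by (auto intro!: set_integrable_subset[OF int0])
  have "{x..} = {x..<y} \<union> {y..}" "{x..<y} \<inter> {y..} = {}"
    using assms by auto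
  then have eq: "tail_integral u x - tail_integral u y = (LBINT z:{x..<y}. u z)"
    using set_integral_Un[OF _ int(2) int(1)] by (simp add: tail_integral_def)
  have const: "set_integrable lborel {x..<y} (\<lambda>_. c)" "(LBINT z:{x..<y}. c) = c * (y - x)"
    for c :: real
    using assms by (auto simp: set_integrable_def set_lebesgue_integral_def)
  show "u y * (y - x) \<le> tail_integral u x - tail_integral u y"
    unfolding eq const(2)[symmetric]
    by (rule set_integral_mono) (use anti assms const int in auto)
  show "tail_integral u x - tail_integral u y \<le> u x * (y - x)"
    unfolding eq const(2)[symmetric]
    by (rule set_integral_mono) (use anti assms const int in auto)
qed

lemma tail_integral_nonneg:
  assumes "lsw_initial_data u" "0 \<le> x"
  shows "0 \<le> tail_integral u x"
  unfolding tail_integral_def set_lebesgue_integral_def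
  by (rule integral_nonneg_AE) (use assms in \<open>auto simp: lsw_initial_data_def indicator_def\<close>)

text \<open>
  Write \<open>u\<close> for the initial data and \<open>h\<close> for its tail integral.  The mean residual volume
  \<open>m = h / u\<close> satisfies \<open>m' = \<beta> - 1 \<le> b - 1 < 0\<close> and is positive on \<open>[0, M)\<close>, so \<open>M\<close> is a
  finite number \<open>R\<close> and \<open>(1 - b) (R - x) \<le> m x\<close>; monotonicity of \<open>u\<close> gives \<open>m x \<le> R - x\<close>.
  Since \<open>- u' / u = \<beta> / m\<close>, this bounds the logarithmic derivative of \<open>u\<close> on both sides.
\<close>

lemma initial_data_logarithmic_derivative:
  assumes u: "lsw_initial_data u" and P: "associated_law u P" and M: "M = Linf_norm P"
    and beta: "is_beta_function u M \<beta>"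
    and le_b: "\<And>x. x \<in> beta_domain M \<Longrightarrow> \<beta> x \<le> b" and "b < 1"
  obtains R u' where "M = ereal R" "0 < R"
    and "\<And>x. x \<in> {0..<R} \<Longrightarrow> 0 < u x"
    and "\<And>x. R \<le> x \<Longrightarrow> u x = 0"
    and "\<And>x. x \<in> {0..<R} \<Longrightarrow> (u has_real_derivative u' x) (at x within {0..<R})"
    and "\<And>x. x \<in> {0..<R} \<Longrightarrow> - u' x * ((1 - b) * (R - x)) \<le> b * u x"
    and "\<And>x. x \<in> {0..<R} \<Longrightarrow> \<beta> x * u x \<le> - u' x * (R - x)"
proof -
  define D where "D = beta_domain M"
  define h where "h = tail_integral u"
  have posM: "0 < M"
  proof (rule ccontr)
    assume "\<not> 0 < M"
    then have "Linf_norm P \<le> ereal 0"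
      using M by (simp add: not_less zero_ereal_def)
    then show False
      using support_of_initial_data(2)[OF u P, of 0] initial_data_at_zero_pos[OF u] by simp
  qed
  have D_iff: "x \<in> D \<longleftrightarrow> 0 \<le> x \<and> ereal x < M" for x
    by (simp add: D_def beta_domain_def)
  have D_down: "y \<in> D" if "x \<in> D" "0 \<le> y" "y \<le> x" for x y
    using that by (auto simp: D_iff intro: le_less_trans[of "ereal y" "ereal x"])
  have D_right: "\<exists>y>x. y \<in> D" if x: "x \<in> D" for x
  proof -
    obtain r where "ereal x < ereal r" "ereal r < M"
      using x ereal_dense2[of "ereal x" M] by (auto simp: D_iff)
    then show ?thesis
      using x by (intro exI[of _ r]) (auto simp: D_iff)
  qed
  have upos: "0 < u x" if "x \<in> D" for x
    using support_of_initial_data(1)[OF u P] that M by (auto simp: D_iff)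
  have anti: "u y \<le> u x" if "0 \<le> x" "x \<le> y" for x y
    using u that by (auto simp: lsw_initial_data_def monotone_on_def)
  obtain h1 h2 where
    h1: "\<And>x. x \<in> D \<Longrightarrow> (h has_real_derivative h1 x) (at x within D)" and
    h2: "\<And>x. x \<in> D \<Longrightarrow> (h1 has_real_derivative h2 x) (at x within D)" and
    b_eq: "\<And>x. x \<in> D \<Longrightarrow> \<beta> x = h2 x * h x / (h1 x)\<^sup>2"
    using beta unfolding is_beta_function_def D_def h_def by blast
  \<comment> \<open>The tail integral is differentiable, and its right derivative is \<open>- u\<close> because \<open>u\<close> is
    right-continuous.\<close>
  have h1_eq: "h1 x = - u x" if x: "x \<in> D" for x
  proof -
    obtain y where y: "x < y" "y \<in> D"
      using D_right[OF x] by blast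
    have x0: "0 \<le> x"
      using x by (simp add: D_iff)
    have "{x..y} \<subseteq> D"
      using D_down[OF y(2)] x0 by auto
    then have "(h has_real_derivative h1 x) (at x within {x..y})"
      using h1[OF x] has_field_derivative_subset by blast
    then have lim: "((\<lambda>z. (h z - h x) / (z - x)) \<longlongrightarrow> h1 x) (at_right x)"
      using y by (simp add: has_field_derivative_iff at_within_Icc_at_right)
    have "((\<lambda>z. (h z - h x) / (z - x)) \<longlongrightarrow> - u x) (at_right x)"
    proof (rule tendsto_sandwich)
      have "- u x \<le> (h z - h x) / (z - x)" "(h z - h x) / (z - x) \<le> - u z" if "x < z" for z
        using tail_integral_increment[OF u x0, of z] that
        by (simp_all add: h_def pos_le_divide_eq pos_divide_le_eq)
      then show "\<forall>\<^sub>F z in at_right x. - u x \<le> (h z - h x) / (z - x)"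
        and "\<forall>\<^sub>F z in at_right x. (h z - h x) / (z - x) \<le> - u z"
        by (simp_all add: eventually_at_filter)
      show "((\<lambda>z. - u z) \<longlongrightarrow> - u x) (at_right x)"
        by (intro tendsto_intros initial_data_right_continuous[OF u P x0])
    qed auto
    then show ?thesis
      using lim tendsto_unique trivial_limit_at_right_real by blast
  qed
  have du: "(u has_real_derivative - h2 x) (at x within D)" if "x \<in> D" for x
  proof -
    have "((\<lambda>y. - h1 y) has_real_derivative - h2 x) (at x within D)"
      by (intro derivative_intros h2[OF that])
    then show ?thesis
      by (rule has_field_derivative_transform_within[OF _ zero_less_one that]) (simp add: h1_eq)
  qed
  have h2_nonneg: "0 \<le> h2 x" if x: "x \<in> D" for x
  proof (rule ccontr)
    assume "\<not> 0 \<le> h2 x"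
    then obtain d where d: "d > 0" "\<And>e. 0 < e \<Longrightarrow> x + e \<in> D \<Longrightarrow> e < d \<Longrightarrow> u x < u (x + e)"
      using has_real_derivative_pos_inc_right[OF du[OF x]] by auto
    obtain y where y: "x < y" "y \<in> D"
      using D_right[OF x] by blast
    define e where "e = min (y - x) (d / 2)"
    have "0 < e" "e < d" "x + e \<le> y"
      using y d by (auto simp: e_def)
    moreover have "x + e \<in> D"
      using D_down[OF y(2)] x calculation by (auto simp: D_iff)
    ultimately show False
      using d(2)[of e] anti[of x "x + e"] x by (auto simp: D_iff)
  qed
  define m where "m x = h x / u x" for x
  have dm: "(m has_real_derivative \<beta> x - 1) (at x within D)" if x: "x \<in> D" for x
  proof -
    have "(h has_real_derivative - u x) (at x within D)"
      using h1[OF x] h1_eq[OF x] by simp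
    from DERIV_divide[OF this du[OF x]] upos[OF x]
    have "((\<lambda>x. h x / u x) has_real_derivative (- u x * u x - h x * - h2 x) / (u x * u x)) (at x within D)"
      by simp
    moreover have "(- u x * u x - h x * - h2 x) / (u x * u x) = \<beta> x - 1"
      using upos[OF x] by (simp add: b_eq[OF x] h1_eq[OF x] field_simps power2_eq_square)
    ultimately show ?thesis
      by (simp add: m_def[abs_def])
  qed
  have m_decay: "m y \<le> m x - (1 - b) * (y - x)" if xy: "x \<le> y" "x \<in> D" "y \<in> D" for x y
  proof -
    have sub: "{x..y} \<subseteq> D"
      using D_down[OF xy(3)] xy(2) by (auto simp: D_iff)
    have "m y + (1 - b) * y \<le> m x + (1 - b) * x"
    proof (rule DERIV_nonpos_imp_decreasing_open[OF xy(1)])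
      fix z assume z: "x < z" "z < y"
      have zD: "z \<in> D" and "\<beta> z \<le> b"
        using subsetD[OF sub, of z] z le_b[of z] unfolding D_def by auto
      have "(m has_real_derivative \<beta> z - 1) (at z within {x..y})"
        by (rule has_field_derivative_subset[OF dm[OF zD] sub])
      then have "(m has_real_derivative \<beta> z - 1) (at z)"
        using z by (simp only: at_within_Icc_at)
      then have "((\<lambda>z. m z + (1 - b) * z) has_real_derivative (\<beta> z - 1) + (1 - b) * 1) (at z)"
        by (auto intro!: derivative_eq_intros)
      then show "\<exists>d. ((\<lambda>z. m z + (1 - b) * z) has_real_derivative d) (at z) \<and> d \<le> 0"
        using \<open>\<beta> z \<le> b\<close> by (intro exI[of _ "(\<beta> z - 1) + (1 - b) * 1"]) auto
    next
      have "continuous_on {x..y} m"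
        unfolding continuous_on_eq_continuous_within
        using sub dm by (meson DERIV_continuous continuous_within_subset subsetD)
      then show "continuous_on {x..y} (\<lambda>z. m z + (1 - b) * z)"
        by (intro continuous_intros)
    qed
    then show ?thesis by (simp add: algebra_simps)
  qed
  have m_nonneg: "0 \<le> m x" if "x \<in> D" for x
    using upos[OF that] tail_integral_nonneg[OF u] that by (simp add: m_def h_def D_iff)
  have zero_D: "0 \<in> D"
    using posM by (simp add: D_iff zero_ereal_def)
  obtain R where R: "M = ereal R" "0 < R"
  proof (cases M)
    case PInf
    define y where "y = (m 0 + 1) / (1 - b)"
    have "y \<in> D"
      using PInf m_nonneg[OF zero_D] \<open>b < 1\<close> by (simp add: D_iff y_def)
    then have "0 \<le> m 0 - (1 - b) * (y - 0)"
      using m_decay[of 0 y] m_nonneg[of y] zero_D by (auto simp: D_iff)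
    then show ?thesis
      using \<open>b < 1\<close> by (simp add: y_def)
  qed (use posM that in auto)
  have D_eq: "D = {0..<R}"
    by (auto simp: D_iff R)
  have u_zero: "u x = 0" if "R \<le> x" for x
    using support_of_initial_data(2)[OF u P, of x] that R M by auto
  have m_le: "m x \<le> R - x" if x: "x \<in> D" for x
  proof -
    have "tail_integral u R = (LBINT z:{R..}. 0)"
      unfolding tail_integral_def by (rule set_lebesgue_integral_cong) (auto simp: u_zero)
    then have "h R = 0"
      by (simp add: h_def set_lebesgue_integral_def)
    then have "h x \<le> u x * (R - x)"
      using tail_integral_increment(2)[OF u, of x R] x by (simp add: h_def D_eq)
    then show ?thesis
      using upos[OF x] by (simp add: m_def field_simps)
  qed
  have m_ge: "(1 - b) * (R - x) \<le> m x" if x: "x \<in> D" for x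
  proof (rule field_le_epsilon)
    fix e :: real assume "0 < e"
    define y where "y = max x (R - e / (1 - b))"
    have y: "x \<le> y" "y \<in> D"
      using x \<open>0 < e\<close> \<open>b < 1\<close> by (auto simp: y_def D_eq)
    have "R - e / (1 - b) \<le> y"
      by (simp add: y_def)
    then have "(1 - b) * R - e \<le> (1 - b) * y"
      using \<open>b < 1\<close> by (simp add: field_simps)
    then show "(1 - b) * (R - x) \<le> m x + e"
      using m_decay[OF y(1) x y(2)] m_nonneg[OF y(2)] by (simp add: algebra_simps)
  qed
  have b_u: "\<beta> x * u x = h2 x * m x" if "x \<in> D" for x
    using upos[OF that] by (simp add: b_eq[OF that] h1_eq[OF that] m_def field_simps power2_eq_square)
  show ?thesis
  proof (rule that[OF R, where u' = "\<lambda>x. - h2 x"])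
    fix x assume "x \<in> {0..<R}"
    then have x: "x \<in> D" by (simp add: D_eq)
    show "0 < u x" by (rule upos[OF x])
    show "(u has_real_derivative - h2 x) (at x within {0..<R})"
      using du[OF x] by (simp add: D_eq)
    have "h2 x * ((1 - b) * (R - x)) \<le> h2 x * m x"
      by (rule mult_left_mono[OF m_ge[OF x] h2_nonneg[OF x]])
    also have "\<dots> \<le> b * u x"
      using b_u[OF x] le_b[of x] upos[OF x] x by (simp add: D_def flip: b_u)
    finally show "- (- h2 x) * ((1 - b) * (R - x)) \<le> b * u x" by simp
    show "\<beta> x * u x \<le> - (- h2 x) * (R - x)"
      using mult_left_mono[OF m_le[OF x] h2_nonneg[OF x]] b_u[OF x] by simp
  qed (rule u_zero)
qed

text \<open>A one-sided bound for the logarithmic derivative of \<open>u\<close> by a multiple of that of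
  \<open>R - z\<close> compares \<open>u\<close> with a power of \<open>R - z\<close>.  No sign of \<open>u\<close> is needed, so that the
  lemma applies to \<open>- u\<close> as well.\<close>

lemma powr_weight_mono:
  fixes u :: "real \<Rightarrow> real"
  assumes deriv: "\<And>z. z \<in> {a..<R} \<Longrightarrow> (u has_real_derivative u' z) (at z within {a..<R})"
    and ge: "\<And>z. z \<in> {a<..<R} \<Longrightarrow> 0 \<le> u' z * (R - z) + \<kappa> * u z"
    and z: "a \<le> x" "x \<le> y" "y < R"
  shows "u x * (R - x) powr (- \<kappa>) \<le> u y * (R - y) powr (- \<kappa>)"
proof (rule DERIV_nonneg_imp_increasing_open[OF z(2)])
  fix t assume t: "x < t" "t < y"
  have "(u has_real_derivative u' t) (at t)"
    using deriv[of t] at_within_interior[of t "{a..<R}"] t z by auto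
  then have "((\<lambda>s. u s * (R - s) powr (- \<kappa>)) has_real_derivative
      u' t * (R - t) powr (- \<kappa>) + (- \<kappa> * (R - t) powr (- \<kappa> - 1) * - 1) * u t) (at t)"
    using t z by (auto intro!: derivative_eq_intros)
  moreover have "u' t * (R - t) powr (- \<kappa>) + (- \<kappa> * (R - t) powr (- \<kappa> - 1) * - 1) * u t
      = (R - t) powr (- \<kappa> - 1) * (u' t * (R - t) + \<kappa> * u t)"
  proof -
    have "(R - t) powr (- \<kappa>) = (R - t) powr (- \<kappa> - 1) * (R - t)"
      using t z powr_mult_base[of "R - t" "- \<kappa> - 1"] by (simp add: mult.commute)
    then show ?thesis
      by (simp only:) (simp add: distrib_left mult.commute mult.left_commute)
  qed
  moreover have "0 \<le> (R - t) powr (- \<kappa> - 1) * (u' t * (R - t) + \<kappa> * u t)"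
    using ge[of t] t z by simp
  ultimately show "\<exists>d. ((\<lambda>s. u s * (R - s) powr (- \<kappa>)) has_real_derivative d) (at t) \<and> 0 \<le> d"
    by auto
next
  have "continuous_on {x..y} u"
    unfolding continuous_on_eq_continuous_within
  proof
    fix t assume "t \<in> {x..y}"
    then have "t \<in> {a..<R}" using z by auto
    from DERIV_continuous[OF deriv[OF this]] show "continuous (at t within {x..y}) u"
      by (rule continuous_within_subset) (use z in auto)
  qed
  then show "continuous_on {x..y} (\<lambda>s. u s * (R - s) powr (- \<kappa>))"
    by (intro continuous_intros) (use z in auto)
qed

lemma ratio_powr_iff:
  fixes R x y \<kappa> p q :: real
  assumes "x < R" "y < R"
  shows "((R - y) / (R - x)) powr \<kappa> * p \<le> q \<longleftrightarrow> p * (R - x) powr (- \<kappa>) \<le> q * (R - y) powr (- \<kappa>)"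
proof -
  define a b where "a = (R - x) powr \<kappa>" and "b = (R - y) powr \<kappa>"
  have pos: "0 < a" "0 < b"
    using assms by (auto simp: a_def b_def)
  have "((R - y) / (R - x)) powr \<kappa> = b / a"
    using assms by (simp add: powr_divide a_def b_def)
  moreover have "(R - x) powr (- \<kappa>) = 1 / a" "(R - y) powr (- \<kappa>) = 1 / b"
    by (simp_all add: powr_minus_divide a_def b_def)
  ultimately have "((R - y) / (R - x)) powr \<kappa> * p = b / a * p"
    "p * (R - x) powr (- \<kappa>) = p / a" "q * (R - y) powr (- \<kappa>) = q / b"
    by simp_all
  moreover have "b / a * p \<le> q \<longleftrightarrow> p / a \<le> q / b"
    using pos by (simp add: field_simps)
  ultimately show ?thesis
    by (simp only:)
qed

lemma ratio_powr_le:
  fixes u :: "real \<Rightarrow> real"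
  assumes deriv: "\<And>z. z \<in> {a..<R} \<Longrightarrow> (u has_real_derivative u' z) (at z within {a..<R})"
    and ge: "\<And>z. z \<in> {a<..<R} \<Longrightarrow> - u' z * (R - z) \<le> \<kappa> * u z"
    and z: "a \<le> x" "x \<le> y" "y < R"
  shows "((R - y) / (R - x)) powr \<kappa> * u x \<le> u y"
proof -
  have "u x * (R - x) powr (- \<kappa>) \<le> u y * (R - y) powr (- \<kappa>)"
  proof (rule powr_weight_mono[OF deriv _ z])
    show "0 \<le> u' t * (R - t) + \<kappa> * u t" if "t \<in> {a<..<R}" for t
      using ge[OF that] by linarith
  qed
  then show ?thesis
    using z by (simp add: ratio_powr_iff)
qed

lemma ratio_powr_ge:
  fixes u :: "real \<Rightarrow> real"
  assumes deriv: "\<And>z. z \<in> {a..<R} \<Longrightarrow> (u has_real_derivative u' z) (at z within {a..<R})"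
    and ge: "\<And>z. z \<in> {a<..<R} \<Longrightarrow> \<kappa> * u z \<le> - u' z * (R - z)"
    and z: "a \<le> x" "x \<le> y" "y < R"
  shows "u y \<le> ((R - y) / (R - x)) powr \<kappa> * u x"
proof -
  have "- u x * (R - x) powr (- \<kappa>) \<le> - u y * (R - y) powr (- \<kappa>)"
  proof (rule powr_weight_mono[where u = "\<lambda>x. - u x" and u' = "\<lambda>x. - u' x", OF _ _ z])
    show "((\<lambda>x. - u x) has_real_derivative - u' t) (at t within {a..<R})" if "t \<in> {a..<R}" for t
      by (rule DERIV_minus[OF deriv[OF that]])
    show "0 \<le> - u' t * (R - t) + \<kappa> * - u t" if "t \<in> {a<..<R}" for t
      using ge[OF that] by simp
  qed
  then have "((R - y) / (R - x)) powr \<kappa> * - u x \<le> - u y"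
    using z by (subst ratio_powr_iff) auto
  then show ?thesis
    by simp
qed

section \<open>Moments of order one third\<close>

lemma cube_root_weight_integral:
  fixes c :: real
  assumes "0 \<le> c"
  shows "set_integrable lborel {0..c} (\<lambda>x. x powr (- 2 / 3))"
    and "(LBINT x:{0..c}. x powr (- 2 / 3)) = 3 * root 3 c"
proof -
  have hi: "((\<lambda>x. x powr (- 2 / 3)) has_integral (3 * root 3 c)) {0..c}"
    using has_integral_powr_from_0[of "- 2 / 3" c] assms by (simp add: root_powr_inverse mult.commute)
  then have "(\<lambda>x. x powr (- 2 / 3)) absolutely_integrable_on {0..c}"
    by (intro nonnegative_absolutely_integrable_1) (auto simp: has_integral_integrable)
  then show int: "set_integrable lborel {0..c} (\<lambda>x. x powr (- 2 / 3))"
    by (simp add: set_integrable_def integrable_completion)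
  show "(LBINT x:{0..c}. x powr (- 2 / 3)) = 3 * root 3 c"
    using set_borel_integral_eq_integral(2)[OF int] hi by (simp add: integral_unique)
qed

text \<open>Bounds of \<open>f\<close> on \<open>[0, d]\<close> from below, or on \<open>(d, c]\<close> from above, turned into bounds of its
  integral against \<open>x powr (- 2 / 3)\<close>.\<close>

lemma cube_root_moment_bounds:
  fixes f :: "real \<Rightarrow> real"
  assumes int: "set_integrable lborel {0..} f"
    and nonneg: "\<And>x. 0 \<le> x \<Longrightarrow> 0 \<le> f x"
    and le: "\<And>x. 0 \<le> x \<Longrightarrow> f x \<le> B"
    and supp: "\<And>x. c \<le> x \<Longrightarrow> f x = 0"
    and d: "0 \<le> d" "d \<le> c"
  shows "(\<And>x. 0 \<le> x \<Longrightarrow> x \<le> d \<Longrightarrow> q \<le> f x) \<Longrightarrow>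
      3 * q * root 3 d \<le> (LBINT x:{0..}. x powr (- 2 / 3) * f x)"
    and "(\<And>x. d < x \<Longrightarrow> x \<le> c \<Longrightarrow> f x \<le> q) \<Longrightarrow> 0 \<le> q \<Longrightarrow>
      (LBINT x:{0..}. x powr (- 2 / 3) * f x) \<le> 3 * (B * root 3 d + q * (root 3 c - root 3 d))"
proof -
  define k where "k a x = indicator {0..a} x * x powr (- 2 / 3)" for a x :: real
  have c: "0 \<le> c" using d by simp
  have k_int: "integrable lborel (k a)" "integral\<^sup>L lborel (k a) = 3 * root 3 a"
    if "0 \<le> a" for a
    using cube_root_weight_integral[OF that]
    by (simp_all add: set_integrable_def set_lebesgue_integral_def k_def[abs_def])
  let ?g = "\<lambda>x. indicator {0..} x *\<^sub>R (x powr (- 2 / 3) * f x)"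
  have meas: "?g \<in> borel_measurable lborel"
  proof -
    have "(\<lambda>x. indicator {0..} x *\<^sub>R f x) \<in> borel_measurable lborel"
      using int by (simp add: set_integrable_def)
    then have "(\<lambda>x. x powr (- 2 / 3) * (indicator {0..} x *\<^sub>R f x)) \<in> borel_measurable lborel"
      by measurable
    then show ?thesis
      by (simp add: mult.left_commute)
  qed
  have g_int: "integrable lborel ?g"
  proof (rule Bochner_Integration.integrable_bound[OF _ meas])
    show "integrable lborel (\<lambda>x. B * k c x)"
      using k_int[OF c] by simp
    show "AE x in lborel. norm (?g x) \<le> norm (B * k c x)"
    proof (rule AE_I2)
      fix x :: real
      show "norm (?g x) \<le> norm (B * k c x)"
      proof (cases "0 \<le> x \<and> x \<le> c")
        case True
        then have "x powr (- 2 / 3) * f x \<le> x powr (- 2 / 3) * B"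
          by (intro mult_left_mono le) auto
        with True nonneg[of x] show ?thesis
          using le[of x] by (simp add: k_def mult.commute abs_mult)
      qed (use supp[of x] in \<open>auto simp: indicator_def\<close>)
    qed
  qed
  show "3 * q * root 3 d \<le> (LBINT x:{0..}. x powr (- 2 / 3) * f x)"
    if low: "\<And>x. 0 \<le> x \<Longrightarrow> x \<le> d \<Longrightarrow> q \<le> f x"
  proof -
    have "integral\<^sup>L lborel (\<lambda>x. q * k d x) \<le> integral\<^sup>L lborel ?g"
    proof (rule integral_mono[OF _ g_int])
      show "integrable lborel (\<lambda>x. q * k d x)"
        using k_int[OF d(1)] by simp
      fix x :: real
      show "q * k d x \<le> ?g x"
      proof (cases "0 \<le> x \<and> x \<le> d")
        case True
        then have "x powr (- 2 / 3) * q \<le> x powr (- 2 / 3) * f x"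
          by (intro mult_left_mono low) auto
        with True show ?thesis
          by (simp add: k_def mult.commute)
      qed (use nonneg[of x] in \<open>auto simp: k_def indicator_def\<close>)
    qed
    then show ?thesis
      using k_int[OF d(1)] by (simp add: set_lebesgue_integral_def)
  qed
  show "(LBINT x:{0..}. x powr (- 2 / 3) * f x) \<le> 3 * (B * root 3 d + q * (root 3 c - root 3 d))"
    if up: "\<And>x. d < x \<Longrightarrow> x \<le> c \<Longrightarrow> f x \<le> q" and q: "0 \<le> q"
  proof -
    have "integral\<^sup>L lborel ?g \<le> integral\<^sup>L lborel (\<lambda>x. q * k c x + (B - q) * k d x)"
    proof (rule integral_mono[OF g_int])
      show "integrable lborel (\<lambda>x. q * k c x + (B - q) * k d x)"
        using k_int[OF d(1)] k_int[OF c] by simp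
      fix x :: real
      consider "x < 0 \<or> c < x" | "0 \<le> x" "x \<le> d" | "0 \<le> x" "d < x" "x \<le> c"
        using d by linarith
      then show "?g x \<le> q * k c x + (B - q) * k d x"
      proof cases
        case 1
        then show ?thesis
          using d supp[of x] by (auto simp: k_def indicator_def)
      next
        case 2
        then have "x powr (- 2 / 3) * f x \<le> x powr (- 2 / 3) * B"
          by (intro mult_left_mono le) auto
        with 2 d show ?thesis
          by (simp add: k_def algebra_simps)
      next
        case 3
        then have "x powr (- 2 / 3) * f x \<le> x powr (- 2 / 3) * q"
          by (intro mult_left_mono up) auto
        with 3 d show ?thesis
          by (simp add: k_def algebra_simps)
      qed
    qed
    then show ?thesis
      using k_int[OF d(1)] k_int[OF c] by (simp add: set_lebesgue_integral_def algebra_simps)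
  qed
qed

section \<open>Chords of the cube root\<close>

text \<open>\<open>chord_slope x y\<close> is the slope of the cube root between two nonnegative points, not both
  zero.  The difference quotient is written without cancellation, so that \<open>x = y\<close> is allowed and
  gives the slope of the tangent.\<close>

definition chord_slope :: "real \<Rightarrow> real \<Rightarrow> real" where
  "chord_slope x y = 1 / ((root 3 x)\<^sup>2 + root 3 x * root 3 y + (root 3 y)\<^sup>2)"

lemma chord_slope_denominator_pos:
  assumes "0 < x" "0 \<le> y"
  shows "0 < (root 3 x)\<^sup>2 + root 3 x * root 3 y + (root 3 y)\<^sup>2"
proof -
  have "0 < (root 3 x)\<^sup>2" "0 \<le> root 3 x * root 3 y"
    using assms by simp_all
  then show ?thesis
    by (intro add_pos_nonneg) auto
qed

lemma root3_diff:
  assumes "0 < x" "0 \<le> y"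
  shows "root 3 x - root 3 y = chord_slope x y * (x - y)"
proof -
  have "x - y = root 3 x ^ 3 - root 3 y ^ 3"
    using assms by simp
  also have "\<dots> = (root 3 x - root 3 y) * ((root 3 x)\<^sup>2 + root 3 x * root 3 y + (root 3 y)\<^sup>2)"
    by (simp add: algebra_simps power2_eq_square power3_eq_cube)
  finally have eq: "x - y = (root 3 x - root 3 y) * ((root 3 x)\<^sup>2 + root 3 x * root 3 y + (root 3 y)\<^sup>2)" .
  then show ?thesis
    using chord_slope_denominator_pos[OF assms] unfolding eq chord_slope_def by simp
qed

lemma chord_slope_antimono:
  assumes "0 < x" "0 \<le> y" "y \<le> z"
  shows "chord_slope x z \<le> chord_slope x y"
  unfolding chord_slope_def
  using assms chord_slope_denominator_pos[of x y]
  by (intro divide_left_mono add_mono mult_left_mono power_mono mult_pos_pos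
      chord_slope_denominator_pos) auto

lemma chord_slope_ge:
  assumes "0 < x" "0 \<le> y" "y \<le> x"
  shows "1 \<le> 3 * (root 3 x)\<^sup>2 * chord_slope x y"
proof -
  have "root 3 y \<le> root 3 x" "0 \<le> root 3 y" "0 < root 3 x"
    using assms by auto
  then have "root 3 x * root 3 y \<le> (root 3 x)\<^sup>2" "(root 3 y)\<^sup>2 \<le> (root 3 x)\<^sup>2"
    by (auto simp: power2_eq_square intro: mult_mono mult_left_mono)
  then show ?thesis
    using chord_slope_denominator_pos[OF assms(1,2)] by (simp add: chord_slope_def)
qed

text \<open>Although the cube root has unbounded slope at \<open>0\<close>, the slopes of its chords to a fixed point
  \<open>x\<close> depend on the other end in a Lipschitz way.\<close>

lemma chord_slope_diff_le:
  assumes "0 < x" "0 \<le> y" "y \<le> z" "z \<le> x"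
  shows "root 3 x ^ 5 * (chord_slope x y - chord_slope x z) \<le> 3 * (x - y)"
proof -
  define a b c where "a = root 3 x" and "b = root 3 y" and "c = root 3 z"
  have abc: "0 < a" "0 \<le> b" "b \<le> c" "c \<le> a"
    using assms by (auto simp: a_def b_def c_def)
  define P Q where "P = a\<^sup>2 + a * b + b\<^sup>2" and "Q = a\<^sup>2 + a * c + c\<^sup>2"
  have a2: "0 < a\<^sup>2" using abc by simp
  have P: "a\<^sup>2 \<le> P" and Q: "a\<^sup>2 \<le> Q"
    using abc by (simp_all add: P_def Q_def)
  have pos: "0 < P" "0 < Q"
    using P Q a2 by linarith+
  have "chord_slope x y - chord_slope x z = (Q - P) / (P * Q)"
  proof -
    have "chord_slope x y = 1 / P" "chord_slope x z = 1 / Q"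
      by (simp_all add: chord_slope_def P_def Q_def a_def b_def c_def)
    then show ?thesis
      using pos by (simp add: diff_frac_eq)
  qed
  moreover have "Q - P = (c - b) * (a + b + c)"
    by (simp add: P_def Q_def algebra_simps power2_eq_square)
  ultimately have "chord_slope x y - chord_slope x z = (c - b) * (a + b + c) / (P * Q)"
    by simp
  also have "\<dots> \<le> (a - b) * (3 * a) / (P * Q)"
    using pos abc by (intro divide_right_mono mult_mono mult_nonneg_nonneg) linarith+
  also have "\<dots> \<le> (a - b) * (3 * a) / (P * a\<^sup>2)"
    using Q pos a2 abc by (intro divide_left_mono mult_left_mono mult_pos_pos mult_nonneg_nonneg) linarith+
  finally have "a ^ 5 * (chord_slope x y - chord_slope x z) \<le> a ^ 5 * ((a - b) * (3 * a) / (P * a\<^sup>2))"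
    using abc by (intro mult_left_mono) auto
  also have "\<dots> = 3 * (a - b) * (a\<^sup>2 * a\<^sup>2) / P"
    using abc pos by (simp add: field_simps power2_eq_square power_numeral_reduce)
  also have "\<dots> \<le> 3 * (a - b) * (P * P) / P"
    using P pos abc by (intro divide_right_mono mult_left_mono mult_mono) auto
  also have "\<dots> = 3 * (a - b) * P"
    using pos by simp
  also have "\<dots> = 3 * (a ^ 3 - b ^ 3)"
    by (simp add: P_def algebra_simps power2_eq_square power3_eq_cube)
  also have "\<dots> = 3 * (x - y)"
    using assms by (simp add: a_def b_def)
  finally show ?thesis
    by (simp add: a_def)
qed

lemma root3_le_add_one:
  fixes x :: real
  assumes "0 \<le> x"
  shows "root 3 x \<le> 1 + x"
proof (cases "x \<le> 1")
  case True
  then have "root 3 x \<le> 1"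
    by simp
  then show ?thesis
    using assms by linarith
next
  case False
  then have "root 3 x \<le> x"
    using real_root_decreasing[of 1 3 x] by simp
  then show ?thesis
    by simp
qed

section \<open>Characteristics\<close>

lemma characteristic_restrict:
  assumes "lsw_characteristic L t x \<xi>" "0 \<le> s" "s \<le> t"
  shows "lsw_characteristic L s (\<xi> s) \<xi>"
proof -
  have "{0..s} \<subseteq> {0..t}" using assms by auto
  then show ?thesis
    using assms(1) has_field_derivative_subset unfolding lsw_characteristic_def by blast
qed

lemma characteristic_nonneg:
  "lsw_characteristic L t x \<xi> \<Longrightarrow> s \<in> {0..t} \<Longrightarrow> 0 \<le> \<xi> s"
  by (auto simp: lsw_characteristic_def)

lemma characteristic_end: "lsw_characteristic L t x \<xi> \<Longrightarrow> \<xi> t = x"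
  by (simp add: lsw_characteristic_def)

lemma characteristic_continuous:
  assumes "lsw_characteristic L t x \<xi>"
  shows "continuous_on {0..t} \<xi>"
  using assms unfolding lsw_characteristic_def continuous_on_eq_continuous_within
  by (blast intro: DERIV_continuous)

lemma characteristic_deriv:
  assumes "lsw_characteristic L t x \<xi>" "0 < s" "s < t"
  shows "(\<xi> has_real_derivative root 3 (\<xi> s) / root 3 (L s) - 1) (at s)"
proof -
  have "(\<xi> has_real_derivative - (1 - root 3 (\<xi> s / L s))) (at s within {0..t})"
    using assms by (auto simp: lsw_characteristic_def)
  then show ?thesis
    using assms by (simp add: at_within_Icc_at real_root_divide)
qed

text \<open>Volumes decrease at rate \<open>1\<close> near \<open>0\<close>, so that a characteristic can only be at \<open>0\<close> at its end.\<close>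

lemma characteristic_pos:
  assumes \<xi>: "lsw_characteristic L t x \<xi>" and s: "0 \<le> s" "s < t"
  shows "0 < \<xi> s"
proof (rule ccontr)
  assume "\<not> 0 < \<xi> s"
  then have "\<xi> s = 0"
    using characteristic_nonneg[OF \<xi>, of s] s by auto
  moreover have "(\<xi> has_real_derivative - (1 - root 3 (\<xi> s / L s))) (at s within {0..t})"
    using \<xi> s by (auto simp: lsw_characteristic_def)
  ultimately have "(\<xi> has_real_derivative - 1) (at s within {0..t})"
    by simp
  from has_real_derivative_neg_dec_right[OF this]
  obtain d where d: "0 < d" "\<And>h. 0 < h \<Longrightarrow> s + h \<in> {0..t} \<Longrightarrow> h < d \<Longrightarrow> \<xi> (s + h) < \<xi> s"
    by auto
  define h where "h = min (t - s) (d / 2)"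
  have "\<xi> (s + h) < \<xi> s"
    using s d(1) by (intro d(2)) (auto simp: h_def)
  moreover have "0 \<le> \<xi> (s + h)"
    using s d(1) by (intro characteristic_nonneg[OF \<xi>]) (auto simp: h_def)
  ultimately show False
    using \<open>\<xi> s = 0\<close> by simp
qed

text \<open>The speed of a cluster increases with its volume, so gaps between characteristics grow with
  time.  Backward uniqueness and the preservation of order follow; no Lipschitz condition is
  used.\<close>

lemma characteristic_gap_abs_mono:
  assumes \<xi>: "lsw_characteristic L t x \<xi>" and \<eta>: "lsw_characteristic L t y \<eta>"
    and L: "\<And>s. 0 \<le> s \<Longrightarrow> 0 < L s"
    and s: "0 \<le> r" "r \<le> s" "s \<le> t"
  shows "\<bar>\<eta> r - \<xi> r\<bar> \<le> \<bar>\<eta> s - \<xi> s\<bar>"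
proof -
  have "(\<eta> r - \<xi> r)\<^sup>2 \<le> (\<eta> s - \<xi> s)\<^sup>2"
  proof (rule DERIV_nonneg_imp_increasing_open[OF s(2)])
    fix v assume v: "r < v" "v < s"
    let ?d = "2 * ((\<eta> v - \<xi> v) * (root 3 (\<eta> v) - root 3 (\<xi> v)) / root 3 (L v))"
    have "((\<lambda>v. (\<eta> v - \<xi> v)\<^sup>2) has_real_derivative ?d) (at v)"
      using characteristic_deriv[OF \<xi>, of v] characteristic_deriv[OF \<eta>, of v] v s
      by (auto intro!: derivative_eq_intros simp: diff_divide_distrib[symmetric] mult.commute)
    moreover have "0 \<le> (\<eta> v - \<xi> v) * (root 3 (\<eta> v) - root 3 (\<xi> v))"
      by (cases "\<xi> v \<le> \<eta> v") (auto intro: mult_nonneg_nonneg mult_nonpos_nonpos)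
    then have "0 \<le> ((\<eta> v - \<xi> v) * (root 3 (\<eta> v) - root 3 (\<xi> v))) / root 3 (L v)"
      using L[of v] v s by (intro divide_nonneg_nonneg) auto
    then have "0 \<le> ?d"
      by (rule mult_nonneg_nonneg[OF zero_le_numeral])
    ultimately show "\<exists>d. ((\<lambda>v. (\<eta> v - \<xi> v)\<^sup>2) has_real_derivative d) (at v) \<and> 0 \<le> d"
      by blast
  next
    have "{r..s} \<subseteq> {0..t}" using s by auto
    then show "continuous_on {r..s} (\<lambda>v. (\<eta> v - \<xi> v)\<^sup>2)"
      using characteristic_continuous[OF \<xi>] characteristic_continuous[OF \<eta>]
      by (intro continuous_intros) (auto intro: continuous_on_subset)
  qed
  then show ?thesis
    by (simp add: abs_le_square_iff)
qed

lemma characteristic_order: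
  assumes \<xi>: "lsw_characteristic L t x \<xi>" and \<eta>: "lsw_characteristic L t y \<eta>"
    and L: "\<And>s. 0 \<le> s \<Longrightarrow> 0 < L s"
    and "x \<le> y" and s: "0 \<le> s" "s \<le> t"
  shows "\<xi> s \<le> \<eta> s"
proof (rule ccontr)
  assume "\<not> \<xi> s \<le> \<eta> s"
  moreover have "{s..t} \<subseteq> {0..t}" using s by auto
  then have "continuous_on {s..t} (\<lambda>v. \<eta> v - \<xi> v)"
    using characteristic_continuous[OF \<xi>] characteristic_continuous[OF \<eta>]
    by (intro continuous_intros) (auto intro: continuous_on_subset)
  ultimately obtain v where v: "s \<le> v" "v \<le> t" "\<eta> v - \<xi> v = 0"
    using IVT'[of "\<lambda>v. \<eta> v - \<xi> v" s 0 t] s \<open>x \<le> y\<close> characteristic_end[OF \<xi>] characteristic_end[OF \<eta>]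
    by auto
  then have "\<bar>\<eta> s - \<xi> s\<bar> \<le> 0"
    using characteristic_gap_abs_mono[OF \<xi> \<eta> L s(1) v(1,2)] by simp
  with \<open>\<not> \<xi> s \<le> \<eta> s\<close> show False by simp
qed

lemma characteristic_gap_mono:
  assumes \<xi>: "lsw_characteristic L t x \<xi>" and \<eta>: "lsw_characteristic L t y \<eta>"
    and L: "\<And>s. 0 \<le> s \<Longrightarrow> 0 < L s"
    and "x \<le> y" and s: "0 \<le> r" "r \<le> s" "s \<le> t"
  shows "\<eta> r - \<xi> r \<le> \<eta> s - \<xi> s"
  using characteristic_gap_abs_mono[OF \<xi> \<eta> L s] characteristic_order[OF \<xi> \<eta> L \<open>x \<le> y\<close>, of r]
    characteristic_order[OF \<xi> \<eta> L \<open>x \<le> y\<close>, of s] s by auto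

section \<open>Solutions with compactly supported initial data\<close>

text \<open>A solution whose initial data are decreasing and positive exactly on \<open>[0, R)\<close>.\<close>

locale lsw_compact =
  fixes w\<^sub>0 :: "real \<Rightarrow> real" and w :: "real \<Rightarrow> real \<Rightarrow> real" and L :: "real \<Rightarrow> real" and R :: real
  assumes R_pos: "0 < R"
    and solution: "lsw_solution w\<^sub>0 w L"
    and w0_pos: "x \<in> {0..<R} \<Longrightarrow> 0 < w\<^sub>0 x"
    and w0_zero: "R \<le> x \<Longrightarrow> w\<^sub>0 x = 0"
    and w0_antimono: "0 \<le> x \<Longrightarrow> x \<le> y \<Longrightarrow> w\<^sub>0 y \<le> w\<^sub>0 x"
begin

lemma L_pos: "0 \<le> t \<Longrightarrow> 0 < L t"
  using solution by (simp add: lsw_solution_def)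

lemma mass:
  assumes "0 \<le> t"
  shows "set_integrable lborel {0..} (\<lambda>x. w x t)" "(LBINT x:{0..}. w x t) = 1"
  using solution assms by (simp_all add: lsw_solution_def)

text \<open>\<open>traj t x\<close> is the characteristic on \<open>[0, t]\<close> that ends at \<open>x\<close>, and its foot \<open>traj t x 0\<close> is
  \<open>F(x,t)\<close>.  Characteristics are unique by \<open>characteristic_gap_abs_mono\<close>, so the choice is immaterial.\<close>

definition traj :: "real \<Rightarrow> real \<Rightarrow> real \<Rightarrow> real" where
  "traj t x = (SOME \<xi>. lsw_characteristic L t x \<xi> \<and> w x t = w\<^sub>0 (\<xi> 0))"

lemma traj:
  assumes "0 \<le> x" "0 \<le> t"
  shows "lsw_characteristic L t x (traj t x)" and "w x t = w\<^sub>0 (traj t x 0)"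
proof -
  have "\<exists>\<xi>. lsw_characteristic L t x \<xi> \<and> w x t = w\<^sub>0 (\<xi> 0)"
    using solution assms by (simp add: lsw_solution_def)
  from someI_ex[OF this] show "lsw_characteristic L t x (traj t x)" "w x t = w\<^sub>0 (traj t x 0)"
    by (simp_all add: traj_def)
qed

lemma w0_nonneg: "0 \<le> x \<Longrightarrow> 0 \<le> w\<^sub>0 x"
  using w0_pos[of x] w0_zero[of x] by (cases "x < R") auto

lemma foot_nonneg: "0 \<le> x \<Longrightarrow> 0 \<le> t \<Longrightarrow> 0 \<le> traj t x 0"
  using characteristic_nonneg[OF traj(1)] by simp

lemma foot_mono: "0 \<le> x \<Longrightarrow> x \<le> y \<Longrightarrow> 0 \<le> t \<Longrightarrow> traj t x 0 \<le> traj t y 0"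
  using characteristic_order[OF traj(1) traj(1) L_pos] by simp

lemma foot_contraction:
  "0 \<le> x \<Longrightarrow> 0 \<le> y \<Longrightarrow> 0 \<le> t \<Longrightarrow> \<bar>traj t y 0 - traj t x 0\<bar> \<le> \<bar>y - x\<bar>"
  using characteristic_gap_abs_mono[OF traj(1) traj(1) L_pos, of x t y 0 t]
  by (simp add: characteristic_end[OF traj(1)])

lemma foot_continuous:
  assumes t: "0 \<le> t"
  shows "continuous_on {0..a} (\<lambda>y. traj t y 0)"
proof (rule continuous_onI)
  fix y e :: real assume y: "y \<in> {0..a}" and e: "0 < e"
  have "dist (traj t z 0) (traj t y 0) \<le> e" if "z \<in> {0..a}" "dist z y < e" for z
    using foot_contraction[of y z t] y t that by (simp add: dist_real_def)
  then show "\<exists>d>0. \<forall>z\<in>{0..a}. dist z y < d \<longrightarrow> dist (traj t z 0) (traj t y 0) \<le> e"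
    using e by blast
qed

lemma w_nonneg: "0 \<le> x \<Longrightarrow> 0 \<le> t \<Longrightarrow> 0 \<le> w x t"
  by (simp add: traj(2) w0_nonneg foot_nonneg)

lemma w_le_w_zero: "0 \<le> x \<Longrightarrow> 0 \<le> t \<Longrightarrow> w x t \<le> w 0 t"
  by (simp add: traj(2) w0_antimono foot_mono foot_nonneg)

text \<open>Mass conservation: at no time has everything dissolved.\<close>

lemma foot_zero_less:
  assumes "0 \<le> t"
  shows "traj t 0 0 < R"
proof (rule ccontr)
  assume "\<not> traj t 0 0 < R"
  then have "w x t = 0" if "0 \<le> x" for x
    using foot_mono[of 0 x t] assms that by (simp add: traj(2) w0_zero)
  then have "(LBINT x:{0..}. w x t) = (LBINT x:{0::real..}. 0)"
    by (intro set_lebesgue_integral_cong) auto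
  then show False
    using mass(2)[OF assms] by (simp add: set_lebesgue_integral_def)
qed

lemma w_zero_pos: "0 \<le> t \<Longrightarrow> 0 < w 0 t"
  by (simp add: traj(2) w0_pos foot_nonneg foot_zero_less)

text \<open>Feet reach every volume, because clusters grow at most exponentially.\<close>

lemma foot_unbounded:
  assumes T: "0 \<le> T"
  obtains x where "0 \<le> x" "a \<le> traj T x 0"
proof -
  have cont: "continuous_on {0..T} L"
    using solution by (auto simp: lsw_solution_def intro: continuous_on_subset)
  obtain v where v: "v \<in> {0..T}" "\<And>s. s \<in> {0..T} \<Longrightarrow> L v \<le> L s"
    using continuous_attains_inf[OF _ _ cont] T by auto
  define K where "K = 1 / root 3 (L v)"
  have Lv: "0 < root 3 (L v)"
    using L_pos[of v] v(1) by simp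
  \<comment> \<open>\<open>(1 + \<xi> s) * exp (- K * s)\<close> decreases along a characteristic, so an end this large
    forces a foot of at least \<open>a\<close>.\<close>
  define x where "x = exp (K * T) * (1 + \<bar>a\<bar>)"
  have x: "0 \<le> x" by (simp add: x_def)
  let ?\<xi> = "traj T x"
  note \<xi> = traj(1)[OF x T]
  have "(1 + ?\<xi> T) * exp (- K * T) \<le> (1 + ?\<xi> 0) * exp (- K * 0)"
  proof (rule DERIV_nonpos_imp_decreasing_open[OF T])
    fix s assume s: "0 < s" "s < T"
    have nn: "0 \<le> ?\<xi> s"
      using characteristic_nonneg[OF \<xi>] s by simp
    have "root 3 (?\<xi> s) / root 3 (L s) \<le> root 3 (?\<xi> s) / root 3 (L v)"
      using v(2)[of s] s Lv nn by (intro divide_left_mono mult_pos_pos) (auto intro: less_le_trans)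
    also have "\<dots> \<le> (1 + ?\<xi> s) / root 3 (L v)"
      using root3_le_add_one[OF nn] Lv by (intro divide_right_mono) auto
    finally have le: "root 3 (?\<xi> s) / root 3 (L s) - 1 - K * (1 + ?\<xi> s) \<le> 0"
      by (simp add: K_def)
    have "((\<lambda>s. (1 + ?\<xi> s) * exp (- K * s)) has_real_derivative
       (root 3 (?\<xi> s) / root 3 (L s) - 1 - K * (1 + ?\<xi> s)) * exp (- K * s)) (at s)"
      by (auto intro!: derivative_eq_intros characteristic_deriv[OF \<xi>] s simp: algebra_simps)
    then show "\<exists>d. ((\<lambda>s. (1 + ?\<xi> s) * exp (- K * s)) has_real_derivative d) (at s) \<and> d \<le> 0"
      using le mult_nonpos_nonneg[OF le, of "exp (- K * s)"] by auto
  next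
    show "continuous_on {0..T} (\<lambda>s. (1 + ?\<xi> s) * exp (- K * s))"
      by (intro continuous_intros characteristic_continuous[OF \<xi>])
  qed
  then have "(1 + x) * exp (- K * T) \<le> 1 + ?\<xi> 0"
    by (simp add: characteristic_end[OF \<xi>])
  moreover have "(1 + x) * exp (- K * T) = exp (- K * T) + (1 + \<bar>a\<bar>)"
    by (simp add: x_def algebra_simps flip: exp_add)
  ultimately have "a \<le> ?\<xi> 0"
    using exp_gt_zero[of "- K * T"] by linarith
  with x show ?thesis by (rule that)
qed

text \<open>The largest cluster can be followed up to any time.\<close>

lemma front_exists:
  assumes T: "0 \<le> T"
  obtains X where "lsw_characteristic L T (X T) X" "X 0 = R"
proof -
  obtain x where x: "0 \<le> x" "R \<le> traj T x 0"
    using foot_unbounded[OF T] by blast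
  obtain y where y: "0 \<le> y" "traj T y 0 = R"
    using IVT'[of "\<lambda>y. traj T y 0" 0 R x] foot_continuous[OF T] foot_zero_less[OF T] x by auto
  then show ?thesis
    using that[of "traj T y"] traj(1)[OF y(1) T] characteristic_end[OF traj(1)[OF y(1) T]] by simp
qed

end

section \<open>The largest cluster\<close>

text \<open>\<open>X\<close> is the volume of the largest cluster, followed on \<open>[0, T]\<close>.\<close>

locale lsw_front = lsw_compact +
  fixes T :: real and X :: "real \<Rightarrow> real"
  assumes T_nonneg: "0 \<le> T"
    and front: "lsw_characteristic L T (X T) X"
    and front_zero: "X 0 = R"
begin

lemma front_at: "0 \<le> s \<Longrightarrow> s \<le> T \<Longrightarrow> lsw_characteristic L s (X s) X"
  by (rule characteristic_restrict[OF front])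

lemma traj_le_front:
  assumes "0 \<le> y" "y \<le> X s" "0 \<le> v" "v \<le> s" "s \<le> T"
  shows "traj s y v \<le> X v"
  using assms by (intro characteristic_order[OF traj(1) front_at L_pos]) auto

lemma w_beyond_front:
  assumes "0 \<le> s" "s \<le> T" "X s \<le> y"
  shows "w y s = 0"
proof -
  have "0 \<le> y"
    using characteristic_nonneg[OF front, of s] assms by simp
  then have "R \<le> traj s y 0"
    using characteristic_order[OF front_at traj(1) L_pos, of s y 0] assms front_zero by simp
  then show ?thesis
    using \<open>0 \<le> y\<close> assms by (simp add: traj(2) w0_zero)
qed

lemma front_pos:
  assumes "0 \<le> s" "s \<le> T"
  shows "0 < X s"
  using w_beyond_front[of s 0] w_zero_pos[of s] assms by (cases "0 < X s") auto

lemma cube_root_mean: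
  assumes "0 \<le> s"
  shows "root 3 (L s) = (1 / 3) * (LBINT x:{0..}. x powr (- 2 / 3) * w x s) / w 0 s"
  using solution assms by (simp add: lsw_solution_def)

text \<open>The cube root of \<open>L\<close> is the mean cube root of the cluster volume, hence these bounds in
  terms of the profile \<open>w y s / w 0 s\<close>.\<close>

lemma root3_L_bounds:
  assumes s: "0 \<le> s" "s \<le> T" and d: "0 \<le> d" "d \<le> X s"
  shows "(\<And>y. 0 \<le> y \<Longrightarrow> y \<le> d \<Longrightarrow> q * w 0 s \<le> w y s) \<Longrightarrow> q * root 3 d \<le> root 3 (L s)"
    and "(\<And>y. d < y \<Longrightarrow> y \<le> X s \<Longrightarrow> w y s \<le> q * w 0 s) \<Longrightarrow> 0 \<le> q \<Longrightarrow>
      root 3 (L s) \<le> root 3 d + q * (root 3 (X s) - root 3 d)"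
proof -
  have W: "0 < w 0 s" by (rule w_zero_pos[OF s(1)])
  show "q * root 3 d \<le> root 3 (L s)"
    if low: "\<And>y. 0 \<le> y \<Longrightarrow> y \<le> d \<Longrightarrow> q * w 0 s \<le> w y s"
  proof -
    have "3 * (q * w 0 s) * root 3 d \<le> (LBINT x:{0..}. x powr (- 2 / 3) * w x s)"
      by (rule cube_root_moment_bounds(1)[where B = "w 0 s" and c = "X s"])
         (use mass(1) w_nonneg w_le_w_zero w_beyond_front s d low in auto)
    then show ?thesis
      using W by (simp add: cube_root_mean[OF s(1)] field_simps)
  qed
  show "root 3 (L s) \<le> root 3 d + q * (root 3 (X s) - root 3 d)"
    if up: "\<And>y. d < y \<Longrightarrow> y \<le> X s \<Longrightarrow> w y s \<le> q * w 0 s" and q: "0 \<le> q"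
  proof -
    have "(LBINT x:{0..}. x powr (- 2 / 3) * w x s)
        \<le> 3 * (w 0 s * root 3 d + q * w 0 s * (root 3 (X s) - root 3 d))"
      by (rule cube_root_moment_bounds(2))
         (use mass(1) w_nonneg w_le_w_zero w_beyond_front s d up q W in auto)
    then show ?thesis
      using W by (simp add: cube_root_mean[OF s(1)] field_simps)
  qed
qed

lemma root3_L_le_front:
  assumes s: "0 \<le> s" "s \<le> T"
  shows "root 3 (L s) \<le> root 3 (X s)"
  using root3_L_bounds(2)[OF s, of 0 1] front_pos[OF s] w_le_w_zero[OF _ s(1)] by simp

lemma front_deriv:
  "0 < s \<Longrightarrow> s < T \<Longrightarrow> (X has_real_derivative root 3 (X s) / root 3 (L s) - 1) (at s)"
  by (rule characteristic_deriv[OF front])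

lemma gap_deriv:
  assumes "0 \<le> y" "0 < v" "v < s" "s \<le> T"
  shows "((\<lambda>v. X v - traj s y v) has_real_derivative
    chord_slope (X v) (traj s y v) * (X v - traj s y v) / root 3 (L v)) (at v)"
proof -
  have \<xi>: "lsw_characteristic L s y (traj s y)"
    using assms by (intro traj(1)) auto
  have "((\<lambda>v. X v - traj s y v) has_real_derivative
      root 3 (X v) / root 3 (L v) - 1 - (root 3 (traj s y v) / root 3 (L v) - 1)) (at v)"
    using assms by (intro derivative_intros front_deriv characteristic_deriv[OF \<xi>]) auto
  moreover have "root 3 (X v) - root 3 (traj s y v) = chord_slope (X v) (traj s y v) * (X v - traj s y v)"
    using assms by (intro root3_diff front_pos characteristic_nonneg[OF \<xi>]) auto
  ultimately show ?thesis
    by (simp add: diff_divide_distrib[symmetric])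
qed

lemma gap_pos:
  assumes "0 \<le> v" "v \<le> s" "s \<le> T"
  shows "0 < X v - traj s 0 v"
proof -
  have s: "0 \<le> s" using assms by simp
  have "0 < X 0 - traj s 0 0"
    using foot_zero_less[OF s] front_zero by simp
  also have "\<dots> \<le> X v - traj s 0 v"
    by (rule characteristic_gap_mono[OF traj(1) front_at L_pos])
       (use assms front_pos[of s] in auto)
  finally show ?thesis .
qed

lemma gap_continuous:
  assumes "0 \<le> y" "0 \<le> s" "s \<le> T"
  shows "continuous_on {0..s} (\<lambda>v. X v - traj s y v)"
  using assms by (intro continuous_on_diff characteristic_continuous[OF front_at]
      characteristic_continuous[OF traj(1)]) auto

lemma chord_slope_front_le:
  assumes "0 \<le> y" "0 \<le> v" "v \<le> s" "s \<le> T"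
  shows "chord_slope (X v) (traj s y v) \<le> chord_slope (X v) (traj s 0 v)"
  using assms
  by (intro chord_slope_antimono front_pos characteristic_nonneg[OF traj(1)]
      characteristic_order[OF traj(1) traj(1) L_pos]) auto

text \<open>By concavity of the cube root, gaps to the largest cluster grow at a relative rate that
  increases with the gap.\<close>

lemma gap_ratio_antimono:
  assumes y: "0 \<le> y" "y \<le> X s" and s: "0 \<le> s" "s \<le> T"
  shows "(X s - y) / X s \<le> (R - traj s y 0) / (R - traj s 0 0)"
proof -
  let ?N = "\<lambda>v. X v - traj s y v" and ?D = "\<lambda>v. X v - traj s 0 v"
  have "?N s / ?D s \<le> ?N 0 / ?D 0"
  proof (rule DERIV_nonpos_imp_decreasing_open[OF s(1)])
    fix v assume v: "0 < v" "v < s"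
    define p q l where "p = chord_slope (X v) (traj s y v)" and "q = chord_slope (X v) (traj s 0 v)"
      and "l = root 3 (L v)"
    have D: "0 < ?D v"
      using gap_pos v s by simp
    have "((\<lambda>v. ?N v / ?D v) has_real_derivative
        (p * ?N v / l * ?D v - ?N v * (q * ?D v / l)) / (?D v * ?D v)) (at v)"
      unfolding p_def q_def l_def
      using D by (intro DERIV_divide gap_deriv) (use y v s in auto)
    also have "p * n / l * d - n * (q * d / l) = (p - q) * (n * d / l)" for n d
      by (simp add: algebra_simps diff_divide_distrib)
    finally have deriv: "((\<lambda>v. ?N v / ?D v) has_real_derivative
       (p - q) * (?N v * ?D v / l) / (?D v * ?D v)) (at v)" .
    have "p - q \<le> 0"
      using chord_slope_front_le[of y v s] y v s by (simp add: p_def q_def)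
    moreover have "0 \<le> ?N v * ?D v / l"
      using D traj_le_front[of y s v] L_pos[of v] y v s by (simp add: l_def)
    ultimately have "(p - q) * (?N v * ?D v / l) / (?D v * ?D v) \<le> 0"
      using D by (intro divide_nonpos_nonneg mult_nonpos_nonneg mult_nonneg_nonneg) linarith+
    with deriv show "\<exists>d. ((\<lambda>v. ?N v / ?D v) has_real_derivative d) (at v) \<and> d \<le> 0"
      by blast
  next
    have "?D v \<noteq> 0" if "v \<in> {0..s}" for v
      using gap_pos[of v s] that s by auto
    then show "continuous_on {0..s} (\<lambda>v. ?N v / ?D v)"
      using y s by (intro continuous_on_divide gap_continuous) auto
  qed
  then show ?thesis
    using y s by (simp add: characteristic_end[OF traj(1)] front_zero)
qed

end

section \<open>Data with a small beta function\<close>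

text \<open>The exponent is chosen so that \<open>20 / 21 * root 3 (1 - 271 / 1000) = 20 / 21 * 9 / 10 = 6 / 7\<close>
  comes out in \<open>root3_front_le\<close> below.\<close>

lemma powr_ge_root:
  fixes r :: real
  assumes "271 / 1000 \<le> r"
  shows "20 / 21 \<le> r powr (1 / 32)"
proof -
  have "(20 / 21 :: real) = ((20 / 21) powr 32) powr (1 / 32)"
    unfolding powr_powr by simp
  also have "\<dots> \<le> r powr (1 / 32)"
  proof (rule powr_mono2)
    have "(20 / 21 :: real) powr 32 = (20 / 21) ^ 32"
      using powr_realpow[of "20 / 21 :: real" 32] by simp
    also have "\<dots> \<le> 271 / 1000"
      by (simp add: power_divide)
    finally show "(20 / 21 :: real) powr 32 \<le> r"
      using assms by simp
  qed auto
  finally show ?thesis .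
qed

text \<open>The lower bound for \<open>w\<^sub>0\<close> that follows from \<open>\<beta>\<^sub>0 \<le> b\<close> has exponent \<open>b / (1 - b)\<close>, which is
  \<open>1 / 32\<close> for \<open>b = 1 / 33\<close>.\<close>

locale lsw_narrow = lsw_front +
  assumes ratio_ge: "0 \<le> x \<Longrightarrow> x \<le> y \<Longrightarrow> y \<le> R \<Longrightarrow> x < R \<Longrightarrow>
    ((R - y) / (R - x)) powr (1 / 32) * w\<^sub>0 x \<le> w\<^sub>0 y"
begin

text \<open>Gap ratios to the front are larger at the feet than at the ends, so the lower bound for \<open>w\<^sub>0\<close>
  is passed on to \<open>w\<close> at every time: the distribution of volumes stays concentrated near its
  maximum.\<close>

lemma w_lower_bound:
  assumes s: "0 \<le> s" "s \<le> T" and y: "0 \<le> y" "y \<le> 729 / 1000 * X s"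
  shows "20 / 21 * w 0 s \<le> w y s"
proof -
  have X: "0 < X s" by (rule front_pos[OF s])
  then have yX: "y \<le> X s" using y by simp
  have "271 / 1000 \<le> (X s - y) / X s"
    using X y by (simp add: field_simps)
  also have "\<dots> \<le> (R - traj s y 0) / (R - traj s 0 0)"
    by (rule gap_ratio_antimono[OF y(1) yX s])
  finally have "20 / 21 \<le> ((R - traj s y 0) / (R - traj s 0 0)) powr (1 / 32)"
    by (rule powr_ge_root)
  then have "20 / 21 * w 0 s \<le> ((R - traj s y 0) / (R - traj s 0 0)) powr (1 / 32) * w 0 s"
    using w_zero_pos[OF s(1)] by (intro mult_right_mono) auto
  also have "\<dots> \<le> w y s"
    using s y foot_mono[of 0 y s] foot_nonneg[of 0 s] foot_zero_less[of s] traj_le_front[of y s 0] yX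
    by (simp add: traj(2) ratio_ge front_zero)
  finally show ?thesis .
qed

lemma root3_front_le:
  assumes s: "0 \<le> s" "s \<le> T"
  shows "root 3 (X s) \<le> 7 / 6 * root 3 (L s)"
proof -
  have X: "0 < X s" by (rule front_pos[OF s])
  have "root 3 (729 / 1000) = root 3 ((9 / 10) ^ 3)"
    by (simp add: power_divide)
  also have "\<dots> = 9 / 10"
    by (rule real_root_power_cancel) auto
  finally have "root 3 (729 / 1000 * X s) = 9 / 10 * root 3 (X s)"
    by (simp only: real_root_mult)
  moreover have "20 / 21 * root 3 (729 / 1000 * X s) \<le> root 3 (L s)"
    using X by (intro root3_L_bounds(1)[OF s] w_lower_bound[OF s]) auto
  ultimately show ?thesis by simp
qed

lemma front_le_mean:
  assumes s: "0 \<le> s" "s \<le> T"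
  shows "X s / 2 \<le> 1 / w 0 s"
proof -
  have X: "0 < X s" by (rule front_pos[OF s])
  define d c where "d = 729 / 1000 * X s" and "c = 20 / 21 * w 0 s"
  have eq: "(\<lambda>y. indicator {0..} y *\<^sub>R (indicator {0..d} y * c)) = (\<lambda>y. indicator {0..d} y * c)"
    by (auto simp: indicator_def)
  have "(LBINT y:{0..}. indicator {0..d} y * c) \<le> (LBINT y:{0..}. w y s)"
  proof (rule set_integral_mono[OF _ mass(1)[OF s(1)]])
    show "set_integrable lborel {0..} (\<lambda>y. indicator {0..d} y * c)"
      unfolding set_integrable_def eq using X by (simp add: d_def)
    show "indicator {0..d} y * c \<le> w y s" if "y \<in> {0..}" for y
      using w_lower_bound[OF s, of y] w_nonneg[of y s] that s by (auto simp: indicator_def c_def d_def)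
  qed
  moreover have "(LBINT y:{0..}. indicator {0..d} y * c) = d * c"
    unfolding set_lebesgue_integral_def eq using X by (simp add: d_def)
  ultimately have "d * c \<le> 1"
    by (simp only: mass(2)[OF s(1)])
  then show ?thesis
    using X w_zero_pos[OF s(1)] mult_pos_pos[OF X w_zero_pos[OF s(1)]]
    by (simp add: field_simps c_def d_def)
qed

end

section \<open>Growth of gaps to the largest cluster\<close>

context lsw_narrow
begin

lemma front_rate:
  assumes s: "0 \<le> s" "s \<le> T"
  shows "0 \<le> root 3 (X s) / root 3 (L s) - 1" "root 3 (X s) / root 3 (L s) - 1 \<le> 1 / 6"
  using root3_L_le_front[OF s] root3_front_le[OF s] L_pos[OF s(1)] by (simp_all add: field_simps)

lemma front_continuous: "0 \<le> r \<Longrightarrow> s \<le> T \<Longrightarrow> continuous_on {r..s} X"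
  using continuous_on_subset[OF characteristic_continuous[OF front], of "{r..s}"] by auto

lemma front_mono:
  assumes "0 \<le> r" "r \<le> s" "s \<le> T"
  shows "X r \<le> X s"
proof (rule DERIV_nonneg_imp_increasing_open[OF assms(2)])
  show "\<exists>d. (X has_real_derivative d) (at v) \<and> 0 \<le> d" if "r < v" "v < s" for v
    using front_deriv[of v] front_rate(1)[of v] that assms by auto
qed (use front_continuous assms in auto)

lemma front_le_linear:
  assumes s: "0 \<le> s" "s \<le> T"
  shows "X s \<le> R + s / 6"
proof -
  have "X s - s / 6 \<le> X 0 - 0 / 6"
  proof (rule DERIV_nonpos_imp_decreasing_open[OF s(1)])
    fix v assume v: "0 < v" "v < s"
    have "((\<lambda>v. X v - v / 6) has_real_derivative root 3 (X v) / root 3 (L v) - 1 - 1 / 6) (at v)"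
      using v s by (intro DERIV_diff front_deriv) (auto intro!: derivative_eq_intros)
    then show "\<exists>d. ((\<lambda>v. X v - v / 6) has_real_derivative d) (at v) \<and> d \<le> 0"
      using front_rate(2)[of v] v s by (intro exI conjI) auto
  qed (use front_continuous[of 0 s] s in \<open>auto intro!: continuous_intros\<close>)
  then show ?thesis by (simp add: front_zero)
qed

text \<open>The gap between the largest cluster and the one that has just dissolved at time \<open>s\<close>, as a
  fraction of the largest volume at time \<open>v\<close>.\<close>

definition gap_fraction :: "real \<Rightarrow> real \<Rightarrow> real" where
  "gap_fraction s v = (X v - traj s 0 v) / X v"

lemma gap_fraction_start: "gap_fraction s 0 = (R - traj s 0 0) / R"
  by (simp add: gap_fraction_def front_zero)

lemma gap_fraction_end: "0 \<le> s \<Longrightarrow> s \<le> T \<Longrightarrow> gap_fraction s s = 1"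
  using front_pos[of s] by (simp add: gap_fraction_def characteristic_end[OF traj(1)])

lemma gap_fraction_continuous:
  assumes "0 \<le> s" "s \<le> T"
  shows "continuous_on {0..s} (gap_fraction s)"
  unfolding gap_fraction_def
  using assms front_pos by (intro continuous_on_divide gap_continuous front_continuous) force+

text \<open>The relative growth rate of the gap is at least \<open>1 / (3 X)\<close>, that of \<open>X\<close> at most
  \<open>1 / (6 X)\<close>.\<close>

lemma gap_fraction_deriv:
  assumes v: "0 < v" "v < s" and s: "s \<le> T"
  obtains d where "(gap_fraction s has_real_derivative d) (at v)"
    and "(X v - traj s 0 v) / (6 * (X v)\<^sup>2) \<le> d"
proof -
  define y q l a where "y = X v - traj s 0 v" and "q = chord_slope (X v) (traj s 0 v)"
    and "l = root 3 (L v)" and "a = root 3 (X v)"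
  have X: "0 < X v" and y: "0 < y"
    using front_pos[of v] gap_pos[of v s] v s by (auto simp: y_def)
  have l: "0 < l" "l \<le> a" and a: "0 < a" and rate: "a / l - 1 \<le> 1 / 6"
    using L_pos[of v] root3_L_le_front[of v] X front_rate[of v] v s by (auto simp: l_def a_def)
  have q: "1 \<le> 3 * a\<^sup>2 * q"
    unfolding a_def q_def
    using v s X y by (intro chord_slope_ge characteristic_nonneg[OF traj(1)]) (auto simp: y_def)
  have "(gap_fraction s has_real_derivative (q * y / l * X v - y * (a / l - 1)) / (X v * X v)) (at v)"
    unfolding gap_fraction_def q_def y_def l_def a_def
    using X v s by (intro DERIV_divide gap_deriv front_deriv) auto
  moreover have "y / (6 * (X v)\<^sup>2) \<le> (q * y / l * X v - y * (a / l - 1)) / (X v * X v)"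
  proof -
    have "a ^ 3 = X v" using X by (simp add: a_def)
    have "1 / 3 \<le> a\<^sup>2 * q"
      using q by simp
    also have "\<dots> \<le> a\<^sup>2 * q * (a / l)"
      using l q mult_left_mono[of 1 "a / l" "a\<^sup>2 * q"] by simp
    also have "\<dots> = q / l * X v"
      unfolding \<open>a ^ 3 = X v\<close>[symmetric] by (simp add: power2_eq_square power3_eq_cube)
    finally have "1 / 6 \<le> q / l * X v - (a / l - 1)"
      using rate by linarith
    then have "y * (1 / 6) \<le> y * (q / l * X v - (a / l - 1))"
      using y by (intro mult_left_mono) auto
    then have "y * (1 / 6) / (X v * X v) \<le> (q * y / l * X v - y * (a / l - 1)) / (X v * X v)"
      using X by (intro divide_right_mono) (auto simp: algebra_simps)
    then show ?thesis
      by (simp add: power2_eq_square)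
  qed
  ultimately show ?thesis
    using that unfolding y_def by blast
qed

text \<open>The gap between the largest cluster and a smaller one outgrows the largest cluster itself,
  by comparison with \<open>X v \<le> R + v / 6\<close>.  So clusters of initial volume at most \<open>x\<close> dissolve
  before a time that depends on \<open>x\<close> and \<open>R\<close> only.\<close>

lemma dissolution_time_le:
  assumes s: "0 \<le> s" "s \<le> T" and x: "traj s 0 0 \<le> x" "x < R"
  shows "s \<le> 6 * R * x / (R - x)"
proof -
  have "gap_fraction s 0 / (R + 0 / 6) \<le> gap_fraction s s / (R + s / 6)"
  proof (rule DERIV_nonneg_imp_increasing_open[OF s(1)])
    fix v assume v: "0 < v" "v < s"
    obtain d where d: "(gap_fraction s has_real_derivative d) (at v)"
      "(X v - traj s 0 v) / (6 * (X v)\<^sup>2) \<le> d"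
      using gap_fraction_deriv[OF v s(2)] .
    have X: "0 < X v" and y: "0 < X v - traj s 0 v"
      using front_pos[of v] gap_pos[of v s] v s by auto
    have B: "0 < R + v / 6"
      using v R_pos by simp
    have "((\<lambda>v. gap_fraction s v / (R + v / 6)) has_real_derivative
       (d * (R + v / 6) - gap_fraction s v * (1 / 6)) / ((R + v / 6) * (R + v / 6))) (at v)"
      using B by (auto intro!: derivative_eq_intros d(1))
    moreover have "gap_fraction s v * (1 / 6) = (X v - traj s 0 v) / (6 * (X v)\<^sup>2) * X v"
      using X by (simp add: gap_fraction_def power2_eq_square)
    moreover have "\<dots> \<le> d * (R + v / 6)"
      using d(2) X y front_le_linear[of v] v s
      by (intro mult_mono) (auto intro: order_trans[rotated])
    ultimately show "\<exists>d. ((\<lambda>v. gap_fraction s v / (R + v / 6)) has_real_derivative d) (at v) \<and> 0 \<le> d"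
      by (intro exI conjI) auto
  next
    show "continuous_on {0..s} (\<lambda>v. gap_fraction s v / (R + v / 6))"
      using R_pos by (intro continuous_intros gap_fraction_continuous[OF s]) auto
  qed
  then have "(R - traj s 0 0) / R / R \<le> 1 / (R + s / 6)"
    by (simp add: gap_fraction_start gap_fraction_end[OF s])
  moreover have "(R - x) / R / R \<le> (R - traj s 0 0) / R / R"
    using R_pos x by (intro divide_right_mono) auto
  ultimately have "(R - x) / R / R \<le> 1 / (R + s / 6)"
    by simp
  moreover have "0 < R + s / 6"
    using R_pos s by simp
  ultimately have "(R - x) * (R + s / 6) \<le> R * R"
    using R_pos by (simp add: field_simps)
  then have "s * (R - x) \<le> 6 * R * x"
    by (simp add: algebra_simps)
  then show ?thesis
    using x by (simp add: pos_le_divide_eq)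
qed

text \<open>The reverse of \<open>gap_ratio_antimono\<close>, up to a factor.  The rates of growth of two gaps differ by
  at most \<open>3 D / (X powr (5 / 3) * root 3 L) \<le> 21 * D / (6 * X\<^sup>2)\<close>, where \<open>D\<close> is the larger gap, and
  this is at most \<open>21\<close> times the derivative of \<open>gap_fraction\<close>, which never exceeds \<open>1\<close>.\<close>

lemma gap_ratio_le:
  assumes y: "0 \<le> y" "y \<le> X s" and s: "0 \<le> s" "s \<le> T"
  shows "(R - traj s y 0) / (R - traj s 0 0) \<le> exp 21 * ((X s - y) / X s)"
proof -
  let ?N = "\<lambda>v. X v - traj s y v" and ?D = "\<lambda>v. X v - traj s 0 v"
  have "?N 0 / ?D 0 * exp (21 * gap_fraction s 0) \<le> ?N s / ?D s * exp (21 * gap_fraction s s)"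
  proof (rule DERIV_nonneg_imp_increasing_open[OF s(1)])
    fix v assume v: "0 < v" "v < s"
    obtain d where d: "(gap_fraction s has_real_derivative d) (at v)" "?D v / (6 * (X v)\<^sup>2) \<le> d"
      using gap_fraction_deriv[OF v s(2)] .
    define p q l a E where "p = chord_slope (X v) (traj s y v)" and "q = chord_slope (X v) (traj s 0 v)"
      and "l = root 3 (L v)" and "a = root 3 (X v)" and "E = exp (21 * gap_fraction s v)"
    have X: "0 < X v" and D: "0 < ?D v" and N: "0 \<le> ?N v"
      using front_pos[of v] gap_pos[of v s] traj_le_front[of y s v] v s y by auto
    have l: "0 < l" and a: "0 < a" and al: "a \<le> 7 / 6 * l"
      using L_pos[of v] root3_front_le[of v] X v s by (auto simp: l_def a_def)
    have ratio: "((\<lambda>v. ?N v / ?D v) has_real_derivative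
        (p * ?N v / l * ?D v - ?N v * (q * ?D v / l)) / (?D v * ?D v)) (at v)"
      unfolding p_def q_def l_def
      using D by (intro DERIV_divide gap_deriv) (use y v s in auto)
    have "(p * n / l * d - n * (q * d / l)) / (d * d) = n / d * ((p - q) / l)" if "0 < d" for n d
      using that l by (simp add: field_simps)
    from this[OF D] have "((\<lambda>v. ?N v / ?D v) has_real_derivative ?N v / ?D v * ((p - q) / l)) (at v)"
      using ratio by simp
    then have "((\<lambda>v. ?N v / ?D v * exp (21 * gap_fraction s v)) has_real_derivative
        ?N v / ?D v * ((p - q) / l) * E + E * (21 * d) * (?N v / ?D v)) (at v)"
      unfolding E_def by (intro DERIV_mult DERIV_fun_exp DERIV_cmult d(1))
    also have "m * k * E + E * (21 * d) * m = m * E * (k + 21 * d)" for m k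
      by (simp add: algebra_simps)
    finally have deriv: "((\<lambda>v. ?N v / ?D v * exp (21 * gap_fraction s v)) has_real_derivative
        ?N v / ?D v * E * ((p - q) / l + 21 * d)) (at v)" .
    have "a ^ 5 * (q - p) \<le> 3 * ?D v"
      unfolding a_def p_def q_def
      by (rule chord_slope_diff_le)
         (use X v s y characteristic_nonneg[OF traj(1)] traj_le_front[of y s v]
            characteristic_order[OF traj(1) traj(1) L_pos, of 0 s y v] in auto)
    then have "q - p \<le> 3 * ?D v / a ^ 5"
      using a by (simp add: pos_le_divide_eq mult.commute)
    then have "(q - p) / l \<le> 3 * ?D v / a ^ 5 / l"
      using l by (intro divide_right_mono) auto
    also have "\<dots> \<le> 3 * ?D v / a ^ 5 / (6 / 7 * a)"
      using l a al D by (intro divide_left_mono mult_pos_pos) (auto intro!: divide_nonneg_nonneg)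
    also have "\<dots> = 21 * (?D v / (6 * (a ^ 3)\<^sup>2))"
      using a by (simp add: power2_eq_square power_numeral_reduce)
    also have "a ^ 3 = X v"
      using X by (simp add: a_def)
    also have "21 * (?D v / (6 * (X v)\<^sup>2)) \<le> 21 * d"
      by (rule mult_left_mono[OF d(2)]) simp
    finally have "0 \<le> (p - q) / l + 21 * d"
      by (simp add: diff_divide_distrib)
    then have "0 \<le> ?N v / ?D v * E * ((p - q) / l + 21 * d)"
      using N D by (intro mult_nonneg_nonneg divide_nonneg_nonneg) (auto simp: E_def)
    with deriv show "\<exists>d. ((\<lambda>v. ?N v / ?D v * exp (21 * gap_fraction s v)) has_real_derivative d) (at v) \<and> 0 \<le> d"
      by blast
  next
    have "?D v \<noteq> 0" if "v \<in> {0..s}" for v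
      using gap_pos[of v s] that s by auto
    then show "continuous_on {0..s} (\<lambda>v. ?N v / ?D v * exp (21 * gap_fraction s v))"
      using y s
      by (intro continuous_on_mult continuous_on_exp continuous_on_const continuous_on_divide
          gap_continuous gap_fraction_continuous) auto
  qed
  moreover have "?N 0 / ?D 0 * 1 \<le> ?N 0 / ?D 0 * exp (21 * gap_fraction s 0)"
  proof (rule mult_left_mono)
    show "0 \<le> ?N 0 / ?D 0"
      using gap_pos[of 0 s] traj_le_front[of y s 0] y s by (intro divide_nonneg_nonneg) auto
    show "1 \<le> exp (21 * gap_fraction s 0)"
      using foot_zero_less[OF s(1)] R_pos by (simp add: gap_fraction_start)
  qed
  ultimately show ?thesis
    using y s by (simp add: characteristic_end[OF traj(1)] front_zero gap_fraction_end mult.commute)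
qed

end

section \<open>Data whose beta function stays away from zero\<close>

text \<open>At late times the clusters with volumes between \<open>(1 - exp (- 21) / 2) * X\<close> and \<open>X\<close> have, by
  \<open>gap_ratio_le\<close>, feet at most half as far from \<open>R\<close> as the foot of \<open>0\<close>.  The cube root of the lower
  end of this range, relative to that of \<open>X\<close>, is \<open>front_margin\<close>.\<close>

definition front_margin :: real where
  "front_margin = root 3 (1 - exp (- 21) / 2)"

text \<open>The resulting upper bound for \<open>root 3 L / root 3 X\<close>, if \<open>w\<^sub>0\<close> decays near \<open>R\<close> at least like
  the power \<open>\<delta>\<close> of the distance to \<open>R\<close>.\<close>

definition critical_ratio :: "real \<Rightarrow> real" where
  "critical_ratio \<delta> = front_margin + (1 / 2) powr \<delta> * (1 - front_margin)"

lemma front_margin_bounds: "0 < front_margin" "front_margin < 1"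
proof -
  have "exp (- 21 :: real) < 1" by simp
  then have "exp (- 21 :: real) / 2 < 1" by linarith
  then have "0 < 1 - exp (- 21 :: real) / 2" "1 - exp (- 21 :: real) / 2 < 1"
    by simp_all
  then show "0 < front_margin" "front_margin < 1"
    by (auto simp: front_margin_def)
qed

lemma critical_ratio_bounds:
  assumes "0 < \<delta>"
  shows "0 < critical_ratio \<delta>" "critical_ratio \<delta> < 1"
proof -
  have "(1 / 2 :: real) powr \<delta> < (1 / 2) powr 0"
    using assms by (intro powr_less_mono') auto
  then have "(1 / 2) powr \<delta> * (1 - front_margin) < 1 * (1 - front_margin)"
    using front_margin_bounds by (intro mult_strict_right_mono) auto
  then show "critical_ratio \<delta> < 1"
    by (simp add: critical_ratio_def)
  show "0 < critical_ratio \<delta>"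
    using front_margin_bounds by (simp add: critical_ratio_def add_pos_nonneg)
qed

text \<open>The decay near \<open>R\<close> that follows from \<open>\<delta> \<le> \<beta>\<^sub>0\<close> on \<open>[x\<^sub>0, R)\<close>.\<close>

locale lsw_spread = lsw_narrow +
  fixes x\<^sub>0 \<delta> :: real
  assumes x0_less: "x\<^sub>0 < R" and x0_nonneg: "0 \<le> x\<^sub>0" and \<delta>_pos: "0 < \<delta>"
    and ratio_le: "x\<^sub>0 \<le> x \<Longrightarrow> x \<le> y \<Longrightarrow> y \<le> R \<Longrightarrow> x < R \<Longrightarrow>
      w\<^sub>0 y \<le> ((R - y) / (R - x)) powr \<delta> * w\<^sub>0 x"
begin

text \<open>Once the clusters of initial volume at most \<open>x\<^sub>0\<close> have dissolved, the critical volume \<open>L\<close> stays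
  a fixed factor below the largest volume, which therefore grows at least linearly.\<close>

lemma root3_L_le_critical:
  assumes s: "0 \<le> s" "s \<le> T" "6 * R * x\<^sub>0 / (R - x\<^sub>0) < s"
  shows "root 3 (L s) \<le> critical_ratio \<delta> * root 3 (X s)"
proof -
  have foot: "x\<^sub>0 \<le> traj s 0 0"
    using dissolution_time_le[OF s(1,2) _ x0_less] s(3) by (cases "traj s 0 0 \<le> x\<^sub>0") auto
  have X: "0 < X s" by (rule front_pos[OF s(1,2)])
  let ?d = "(1 - exp (- 21) / 2) * X s"
  have d: "0 \<le> ?d" "?d \<le> X s"
  proof -
    have "exp (- 21 :: real) < 1" by simp
    then have "exp (- 21 :: real) / 2 < 1" by linarith
    then have "0 \<le> 1 - exp (- 21 :: real) / 2" "1 - exp (- 21 :: real) / 2 \<le> 1"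
      by simp_all
    then show "0 \<le> ?d" "?d \<le> X s"
      using X mult_right_mono[of "1 - exp (- 21 :: real) / 2" 1 "X s"] by auto
  qed
  have "w y s \<le> (1 / 2) powr \<delta> * w 0 s" if y: "?d < y" "y \<le> X s" for y
  proof -
    have y0: "0 \<le> y" using d y by simp
    have "(R - traj s y 0) / (R - traj s 0 0) \<le> exp 21 * ((X s - y) / X s)"
      by (rule gap_ratio_le[OF y0 y(2) s(1,2)])
    also have "\<dots> \<le> exp 21 * (exp (- 21) / 2)"
      using X y by (intro mult_left_mono) (auto simp: field_simps)
    also have "\<dots> = 1 / 2"
      by (simp add: exp_minus)
    finally have half: "(R - traj s y 0) / (R - traj s 0 0) \<le> 1 / 2" .
    have le: "traj s y 0 \<le> R"
      using traj_le_front[of y s 0] y0 y s by (simp add: front_zero)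
    have "w y s \<le> ((R - traj s y 0) / (R - traj s 0 0)) powr \<delta> * w 0 s"
      using s y0 foot foot_mono[of 0 y s] foot_zero_less[of s] le
      by (simp add: traj(2) ratio_le)
    also have "\<dots> \<le> (1 / 2) powr \<delta> * w 0 s"
      using half le foot_zero_less[OF s(1)] w_zero_pos[OF s(1)] \<delta>_pos
      by (intro mult_right_mono powr_mono2 divide_nonneg_nonneg) auto
    finally show ?thesis .
  qed
  then have "root 3 (L s) \<le> root 3 ?d + (1 / 2) powr \<delta> * (root 3 (X s) - root 3 ?d)"
    by (intro root3_L_bounds(2) s d) auto
  also have "root 3 ?d = front_margin * root 3 (X s)"
    by (simp add: front_margin_def real_root_mult)
  finally show ?thesis
    by (simp add: critical_ratio_def algebra_simps)
qed

lemma front_ge_linear: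
  assumes "6 * R * x\<^sub>0 / (R - x\<^sub>0) \<le> T"
  shows "(1 / critical_ratio \<delta> - 1) * (T - 6 * R * x\<^sub>0 / (R - x\<^sub>0)) \<le> X T"
proof -
  define t0 c where "t0 = 6 * R * x\<^sub>0 / (R - x\<^sub>0)" and "c = 1 / critical_ratio \<delta> - 1"
  have t0: "0 \<le> t0" "t0 \<le> T"
    using assms x0_nonneg x0_less R_pos by (auto simp: t0_def)
  have "X t0 - c * t0 \<le> X T - c * T"
  proof (rule DERIV_nonneg_imp_increasing_open[OF t0(2)])
    fix v assume v: "t0 < v" "v < T"
    have "root 3 (L v) \<le> critical_ratio \<delta> * root 3 (X v)"
      using v t0 by (intro root3_L_le_critical) (auto simp: t0_def)
    then have "c \<le> root 3 (X v) / root 3 (L v) - 1"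
      using L_pos[of v] v t0 critical_ratio_bounds[OF \<delta>_pos] by (simp add: c_def field_simps)
    moreover have "((\<lambda>v. X v - c * v) has_real_derivative root 3 (X v) / root 3 (L v) - 1 - c) (at v)"
      using v t0 by (auto intro!: derivative_eq_intros front_deriv)
    ultimately show "\<exists>d. ((\<lambda>v. X v - c * v) has_real_derivative d) (at v) \<and> 0 \<le> d"
      by (intro exI conjI) auto
  qed (use front_continuous[of t0 T] t0 in \<open>auto intro!: continuous_intros\<close>)
  then show ?thesis
    using front_pos[of t0] t0 by (simp add: c_def t0_def algebra_simps)
qed

end

section \<open>The mean cluster volume\<close>

lemma has_real_derivative_if_quadratic_error:
  fixes f :: "real \<Rightarrow> real"
  assumes "0 < e" and error: "\<And>z. \<bar>z - y\<bar> < e \<Longrightarrow> \<bar>f z - f y - d * (z - y)\<bar> \<le> K * (z - y)\<^sup>2"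
  shows "(f has_real_derivative d) (at y)"
proof -
  have "((\<lambda>z. (f z - f y) / (z - y) - d) \<longlongrightarrow> 0) (at y)"
  proof (rule Lim_null_comparison)
    have "norm ((f z - f y) / (z - y) - d) \<le> K * \<bar>z - y\<bar>" if z: "z \<noteq> y" "dist z y < e" for z
    proof -
      have "(f z - f y) / (z - y) - d = (f z - f y - d * (z - y)) / (z - y)"
        using z by (simp add: field_simps)
      moreover have "\<bar>f z - f y - d * (z - y)\<bar> \<le> K * \<bar>z - y\<bar> * \<bar>z - y\<bar>"
        using error[of z] z by (simp add: dist_real_def power2_eq_square mult.assoc)
      ultimately show ?thesis
        using z by (simp add: abs_divide pos_divide_le_eq)
    qed
    then show "\<forall>\<^sub>F z in at y. norm ((f z - f y) / (z - y) - d) \<le> K * \<bar>z - y\<bar>"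
      unfolding eventually_at using \<open>0 < e\<close> by blast
    have "((\<lambda>z. K * \<bar>z - y\<bar>) \<longlongrightarrow> K * \<bar>y - y\<bar>) (at y)"
      by (intro tendsto_intros)
    then show "((\<lambda>z. K * \<bar>z - y\<bar>) \<longlongrightarrow> 0) (at y)"
      by simp
  qed
  then show ?thesis
    unfolding has_field_derivative_iff by (rule LIM_zero_cancel)
qed

lemma chord_slope_minus_tangent_le:
  assumes x: "0 < x" and y: "0 \<le> y"
  shows "\<bar>chord_slope x y - 1 / (3 * (root 3 x)\<^sup>2)\<bar> \<le> 2 / (3 * root 3 x ^ 5) * \<bar>x - y\<bar>"
proof -
  define a b P where "a = root 3 x" and "b = root 3 y" and "P = a\<^sup>2 + a * b + b\<^sup>2"
  have a: "0 < a" and b: "0 \<le> b"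
    using assms by (auto simp: a_def b_def)
  have P: "a\<^sup>2 \<le> P"
    using a b by (simp add: P_def)
  have P0: "0 < P"
    using P a by (simp add: less_le_trans[OF zero_less_power])
  have slope: "chord_slope x y = 1 / P"
    by (simp add: chord_slope_def P_def a_def b_def)
  have "a - b = (x - y) / P"
    using root3_diff[OF x y] by (simp add: slope flip: a_def b_def)
  then have "\<bar>a - b\<bar> = \<bar>x - y\<bar> / P"
    using P0 by simp
  also have "\<dots> \<le> \<bar>x - y\<bar> / a\<^sup>2"
    using P P0 a by (intro divide_left_mono mult_pos_pos) auto
  finally have ab: "\<bar>a - b\<bar> \<le> \<bar>x - y\<bar> / a\<^sup>2" .
  have "1 / P - 1 / (3 * a\<^sup>2) = (3 * a\<^sup>2 - P) / (P * (3 * a\<^sup>2))"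
    using P0 a by (simp add: diff_frac_eq)
  also have "3 * a\<^sup>2 - P = (a - b) * (2 * a + b)"
    by (simp add: P_def algebra_simps power2_eq_square)
  finally have "\<bar>1 / P - 1 / (3 * a\<^sup>2)\<bar> = \<bar>a - b\<bar> * (2 * a + b) / (P * (3 * a\<^sup>2))"
    using P0 a b by (simp add: abs_mult)
  also have "\<dots> \<le> \<bar>a - b\<bar> * (2 * P / a) / (P * (3 * a\<^sup>2))"
  proof -
    have "(2 * a + b) * a \<le> 2 * P"
      using a b by (simp add: P_def algebra_simps power2_eq_square)
    then have "2 * a + b \<le> 2 * P / a"
      using a by (simp add: pos_le_divide_eq)
    then show ?thesis
      using P0 a by (intro divide_right_mono mult_left_mono) auto
  qed
  also have "\<dots> = 2 / (3 * a ^ 3) * \<bar>a - b\<bar>"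
    using P0 a by (simp add: field_simps power2_eq_square power3_eq_cube)
  also have "\<dots> \<le> 2 / (3 * a ^ 3) * (\<bar>x - y\<bar> / a\<^sup>2)"
    using a ab by (intro mult_left_mono) auto
  also have "\<dots> = 2 / (3 * a ^ 5) * \<bar>x - y\<bar>"
    by (simp add: power2_eq_square power_numeral_reduce)
  finally show ?thesis
    by (simp add: slope flip: a_def)
qed

context lsw_compact
begin

text \<open>The foot of a characteristic depends differentiably on its end \<open>y > 0\<close>: the gap \<open>D\<close> between
  two characteristics solves \<open>D' = a D\<close>, where \<open>a\<close> is a chord slope divided by \<open>root 3 L\<close>, and
  replacing the chord slope by the slope of the tangent causes an error that is quadratic in the gap.\<close>

lemma foot_differentiable:
  assumes y: "0 < y" and t: "0 < t"
  obtains d where "((\<lambda>y. traj t y 0) has_real_derivative d) (at y)"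
proof -
  let ?\<xi> = "traj t y"
  have y0: "0 \<le> y" and t0: "0 \<le> t" using y t by auto
  note \<xi> = traj(1)[OF y0 t0]
  have \<xi>_pos: "0 < ?\<xi> s" if "s \<in> {0..t}" for s
    using characteristic_pos[OF \<xi>, of s] characteristic_end[OF \<xi>] y that by (cases "s = t") auto
  define b l where "b s = root 3 (?\<xi> s)" and "l s = root 3 (L s)" for s
  have b_pos: "0 < b s" and l_pos: "0 < l s" if "s \<in> {0..t}" for s
    using \<xi>_pos[OF that] L_pos[of s] that by (auto simp: b_def l_def)
  have cont: "continuous_on {0..t} b" "continuous_on {0..t} l"
  proof -
    have "continuous_on {0..t} L"
      using solution by (auto simp: lsw_solution_def intro: continuous_on_subset)
    then show "continuous_on {0..t} l"
      unfolding l_def by (intro continuous_intros)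
    show "continuous_on {0..t} b"
      unfolding b_def by (intro continuous_intros characteristic_continuous[OF \<xi>])
  qed
  define g k where "g s = 1 / (3 * (b s)\<^sup>2) / l s" and "k s = 2 / (3 * b s ^ 5) / l s" for s
  have g_cont: "continuous_on {0..t} g" and k_cont: "continuous_on {0..t} k"
    unfolding g_def k_def using b_pos l_pos by (intro continuous_intros cont; force)+
  \<comment> \<open>\<open>g\<close> is the linearised growth rate, and \<open>k\<close> the coefficient of the error in
    \<open>chord_slope_minus_tangent_le\<close>.\<close>
  obtain s1 where "s1 \<in> {0..t}" "\<And>s. s \<in> {0..t} \<Longrightarrow> k s \<le> k s1"
    using continuous_attains_sup[OF _ _ k_cont] t by auto
  then obtain K where K: "\<And>s. s \<in> {0..t} \<Longrightarrow> k s \<le> K"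
    by blast
  define E where "E s = exp (- integral {0..s} g)" for s
  have E_deriv: "(E has_real_derivative E s * - g s) (at s)" if "s \<in> {0<..<t}" for s
  proof -
    have "((\<lambda>s. integral {0..s} g) has_real_derivative g s) (at s within {0..t})"
      by (rule integral_has_real_derivative[OF g_cont]) (use that in auto)
    then have "((\<lambda>s. integral {0..s} g) has_real_derivative g s) (at s)"
      using that by (simp add: at_within_Icc_at)
    then show ?thesis
      unfolding E_def by (intro DERIV_fun_exp DERIV_minus)
  qed
  have E_cont: "continuous_on {0..t} E"
    unfolding E_def
    by (intro continuous_intros indefinite_integral_continuous_1 integrable_continuous_interval g_cont)
  have E_le: "E s \<le> 1" if "s \<in> {0..t}" for s
  proof -
    have "0 \<le> integral {0..s} g"
    proof (rule integral_nonneg)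
      show "g integrable_on {0..s}"
        by (rule integrable_continuous_interval[OF continuous_on_subset[OF g_cont]]) (use that in auto)
      show "0 \<le> g v" if "v \<in> {0..s}" for v
        using b_pos[of v] l_pos[of v] that \<open>s \<in> {0..t}\<close> by (auto simp: g_def)
    qed
    then show ?thesis by (simp add: E_def)
  qed
  have "\<bar>traj t z 0 - ?\<xi> 0 - E t * (z - y)\<bar> \<le> K * t * (z - y)\<^sup>2" if "\<bar>z - y\<bar> < y" for z
  proof -
    have z: "0 \<le> z" using that by auto
    note \<eta> = traj(1)[OF z t0]
    define D where "D s = traj t z s - ?\<xi> s" for s
    let ?d = "\<lambda>s. E s * D s * (chord_slope (?\<xi> s) (traj t z s) - 1 / (3 * (b s)\<^sup>2)) / l s"
    have deriv: "((\<lambda>s. D s * E s) has_real_derivative ?d s) (at s)" if s: "0 < s" "s < t" for s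
    proof -
      have "(D has_real_derivative root 3 (traj t z s) / l s - 1 - (b s / l s - 1)) (at s)"
        unfolding D_def b_def l_def using s
        by (intro DERIV_diff characteristic_deriv[OF \<xi>] characteristic_deriv[OF \<eta>])
      moreover have "root 3 (traj t z s) - b s = chord_slope (?\<xi> s) (traj t z s) * D s"
        using root3_diff[of "?\<xi> s" "traj t z s"] \<xi>_pos[of s] characteristic_nonneg[OF \<eta>, of s] s
        by (simp add: b_def D_def algebra_simps)
      then have "root 3 (traj t z s) / l s - 1 - (b s / l s - 1)
          = chord_slope (?\<xi> s) (traj t z s) * D s / l s"
        by (simp add: diff_divide_distrib[symmetric])
      ultimately have "(D has_real_derivative chord_slope (?\<xi> s) (traj t z s) * D s / l s) (at s)"
        by simp
      from DERIV_mult[OF this E_deriv[of s]]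
      have "((\<lambda>s. D s * E s) has_real_derivative
          chord_slope (?\<xi> s) (traj t z s) * D s / l s * E s + E s * - g s * D s) (at s)"
        using s by simp
      also have "c * D s / l s * E s + E s * - g s * D s = E s * D s * (c - 1 / (3 * (b s)\<^sup>2)) / l s" for c
        by (simp add: g_def diff_divide_distrib right_diff_distrib mult_ac)
      finally show ?thesis .
    qed
    have bound: "\<bar>?d s\<bar> \<le> K * (z - y)\<^sup>2" if s: "0 < s" "s < t" for s
    proof -
      have D_le: "\<bar>D s\<bar> \<le> \<bar>z - y\<bar>"
        using characteristic_gap_abs_mono[OF \<xi> \<eta> L_pos, of s t] s
        by (simp add: D_def characteristic_end[OF \<xi>] characteristic_end[OF \<eta>])
      have "\<bar>chord_slope (?\<xi> s) (traj t z s) - 1 / (3 * (b s)\<^sup>2)\<bar> \<le> 2 / (3 * b s ^ 5) * \<bar>D s\<bar>"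
        using chord_slope_minus_tangent_le[of "?\<xi> s" "traj t z s"] \<xi>_pos[of s]
          characteristic_nonneg[OF \<eta>, of s] s
        by (simp add: b_def D_def abs_minus_commute)
      then have "\<bar>?d s\<bar> \<le> E s * \<bar>D s\<bar> * (2 / (3 * b s ^ 5) * \<bar>D s\<bar>) / l s"
        using l_pos[of s] s
        by (simp only: abs_mult abs_divide) (intro divide_mono mult_mono, auto simp: E_def)
      also have "\<dots> = E s * (k s * \<bar>D s\<bar>\<^sup>2)"
        by (simp add: k_def power2_eq_square)
      also have "\<dots> \<le> 1 * (K * \<bar>z - y\<bar>\<^sup>2)"
      proof (intro mult_mono power_mono D_le E_le K)
        have "0 \<le> k s"
          using b_pos[of s] l_pos[of s] s by (simp add: k_def)
        then show "0 \<le> k s * \<bar>D s\<bar>\<^sup>2" "0 \<le> K"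
          using K[of s] s by auto
      qed (use s in auto)
      finally show ?thesis by simp
    qed
    have "continuous_on {0..t} (\<lambda>s. D s * E s)"
      unfolding D_def
      by (intro continuous_intros E_cont characteristic_continuous[OF \<xi>] characteristic_continuous[OF \<eta>])
    then obtain l' s where s: "0 < s" "s < t" "((\<lambda>s. D s * E s) has_real_derivative l') (at s)"
      "D t * E t - D 0 * E 0 = (t - 0) * l'"
      using MVT[OF t, of "\<lambda>s. D s * E s"] deriv by (auto simp: real_differentiable_def)
    have "\<bar>l'\<bar> \<le> K * (z - y)\<^sup>2"
      using bound[OF s(1,2)] unfolding DERIV_unique[OF s(3) deriv[OF s(1,2)]] .
    then have "\<bar>D t * E t - D 0 * E 0\<bar> \<le> t * (K * (z - y)\<^sup>2)"
      unfolding s(4) using t by (simp add: abs_mult)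
    then show ?thesis
      by (simp add: D_def E_def characteristic_end[OF \<xi>] characteristic_end[OF \<eta>]
        abs_minus_commute mult_ac)
  qed
  then show ?thesis
    using has_real_derivative_if_quadratic_error[of y y "\<lambda>y. traj t y 0"] y that by blast
qed

end

text \<open>Fundamental theorem of calculus for the Lebesgue integral of a nonnegative derivative on an
  open interval; the integrand need not be continuous, and its value at the end \<open>a\<close> is irrelevant.\<close>

lemma LBINT_nonneg_derivative:
  fixes G f :: "real \<Rightarrow> real"
  assumes a: "0 \<le> a" and cont: "continuous_on {0..a} G"
    and deriv: "\<And>x. 0 < x \<Longrightarrow> x < a \<Longrightarrow> (G has_real_derivative f x) (at x)"
    and nonneg: "\<And>x. 0 < x \<Longrightarrow> x < a \<Longrightarrow> 0 \<le> f x"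
    and zero: "\<And>x. a < x \<Longrightarrow> f x = 0"
  shows "(LBINT x:{0<..}. f x) = G a - G 0"
proof -
  let ?f = "\<lambda>x. indicator {0<..<a} x *\<^sub>R f x"
  have hi: "(f has_integral (G a - G 0)) {0<..<a}"
    using fundamental_theorem_of_calculus_interior[OF a cont, of f] deriv
    by (auto simp: has_integral_Icc_iff_Ioo has_real_derivative_iff_has_vector_derivative)
  define H where "H x = G (max 0 (min a x))" for x
  have H: "continuous_on UNIV H"
    unfolding H_def using a
    by (intro continuous_on_compose2[OF cont] continuous_intros) auto
  \<comment> \<open>On \<open>(0, a)\<close> the derivative is a limit of difference quotients of the continuous extension
    \<open>H\<close> of \<open>G\<close>, and so measurable.\<close>
  have meas: "?f \<in> borel_measurable borel"
  proof (rule borel_measurable_LIMSEQ_real)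
    fix x :: real
    show "(\<lambda>n. indicator {0<..<a} x * ((H (x + 1 / real (Suc n)) - H x) / (1 / real (Suc n)))) \<longlonglongrightarrow> ?f x"
    proof (cases "x \<in> {0<..<a}")
      case True
      have "\<forall>\<^sub>F y in nhds x. y \<in> {0<..<a}"
        using True by (intro eventually_nhds_in_open) auto
      then have "\<forall>\<^sub>F y in nhds x. G y = H y"
        by eventually_elim (simp add: H_def)
      then have "(H has_real_derivative f x) (at x)"
        using deriv[of x] True DERIV_cong_ev[of x x G H "f x" "f x"] by simp
      then have lim: "((\<lambda>h. (H (x + h) - H x) / h) \<longlongrightarrow> f x) (at 0)"
        by (simp add: DERIV_def)
      have "filterlim (\<lambda>n. 1 / real (Suc n)) (at 0) sequentially"
        unfolding filterlim_at using LIMSEQ_inverse_real_of_nat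
        by (auto simp: inverse_eq_divide)
      from filterlim_compose[OF lim this] True show ?thesis
        by simp
    qed simp
    next
    show "(\<lambda>x. indicator {0<..<a} x * ((H (x + 1 / real (Suc n)) - H x) / (1 / real (Suc n)))) \<in> borel_measurable borel" for n
      using borel_measurable_continuous_onI[OF H] by measurable
  qed
  have "f absolutely_integrable_on {0<..<a}"
    using hi nonneg by (intro nonnegative_absolutely_integrable_1) (auto simp: has_integral_integrable)
  then have int: "set_integrable lborel {0<..<a} f"
    using meas by (simp add: set_integrable_def integrable_completion)
  have "(\<lambda>x. indicator {0<..} x *\<^sub>R f x) = (\<lambda>x. ?f x + indicator {a} x * (indicator {0<..} a * f a))"
    using zero a by (auto simp: indicator_def fun_eq_iff)
  then have "(LBINT x:{0<..}. f x) = (LBINT x:{0<..<a}. f x)"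
    using int by (simp add: set_lebesgue_integral_def set_integrable_def)
  also have "\<dots> = G a - G 0"
    using set_borel_integral_eq_integral(2)[OF int] hi by (simp add: integral_unique)
  finally show ?thesis .
qed

text \<open>Initial data for which \<open>w\<close> at time \<open>T\<close> is the integral of its derivative, so that the formula
  \<open>\<Lambda> = 1 / w(0,T)\<close> holds.\<close>

locale lsw_smooth = lsw_front +
  assumes w0_cont: "continuous_on {0..R} w\<^sub>0"
    and w0_differentiable: "0 < x \<Longrightarrow> x < R \<Longrightarrow> \<exists>d. (w\<^sub>0 has_real_derivative d) (at x)"
    and T_pos: "0 < T"
begin

lemma w_differentiable:
  assumes x: "0 < x" "x < X T"
  shows "((\<lambda>y. w y T) has_real_derivative deriv (\<lambda>y. w y T) x) (at x)" and "deriv (\<lambda>y. w y T) x \<le> 0"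
proof -
  have T: "0 \<le> T" using T_pos by simp
  have X: "0 < X T" by (rule front_pos) (use T in auto)
  have "0 < traj T x 0"
    by (rule characteristic_pos[OF traj(1)]) (use x T_pos in auto)
  moreover have "traj T x 0 < R"
  proof -
    have "0 < (X T - x) / X T" using x X by simp
    also have "\<dots> \<le> (R - traj T x 0) / (R - traj T 0 0)"
      by (rule gap_ratio_antimono) (use x T in auto)
    finally show ?thesis
      using foot_zero_less[OF T] by (simp add: zero_less_divide_iff)
  qed
  ultimately obtain d where d: "(w\<^sub>0 has_real_derivative d) (at (traj T x 0))"
    using w0_differentiable by blast
  obtain e where e: "((\<lambda>y. traj T y 0) has_real_derivative e) (at x)"
    using foot_differentiable[OF x(1) T_pos] .
  have "((\<lambda>y. w\<^sub>0 (traj T y 0)) has_real_derivative d * e) (at x)"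
    by (rule DERIV_chain2[OF d e])
  moreover have "\<forall>\<^sub>F y in nhds x. y \<in> {0<..}"
    using x by (intro eventually_nhds_in_open) auto
  then have "\<forall>\<^sub>F y in nhds x. w\<^sub>0 (traj T y 0) = w y T"
    by eventually_elim (use T in \<open>simp add: traj(2)\<close>)
  ultimately have "((\<lambda>y. w y T) has_real_derivative d * e) (at x)"
    by (simp only: DERIV_cong_ev[OF refl _ refl, of "\<lambda>y. w\<^sub>0 (traj T y 0)" "\<lambda>y. w y T"])
  then show D: "((\<lambda>y. w y T) has_real_derivative deriv (\<lambda>y. w y T) x) (at x)"
    by (simp add: DERIV_imp_deriv)
  show "deriv (\<lambda>y. w y T) x \<le> 0"
  proof (rule ccontr)
    assume "\<not> deriv (\<lambda>y. w y T) x \<le> 0"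
    then obtain h where h: "0 < h" "\<And>r. 0 < r \<Longrightarrow> r < h \<Longrightarrow> w x T < w (x + r) T"
      using DERIV_pos_inc_right[OF D] by auto
    have "w (x + h / 2) T \<le> w x T"
      using x h(1) T by (simp add: traj(2) w0_antimono foot_mono foot_nonneg)
    with h(2)[of "h / 2"] h(1) show False by simp
  qed
qed

lemma w_continuous: "continuous_on {0..X T} (\<lambda>y. w y T)"
proof -
  have T: "0 \<le> T" using T_pos by simp
  have "(\<lambda>y. traj T y 0) ` {0..X T} \<subseteq> {0..R}"
    using foot_nonneg[OF _ T] traj_le_front[of _ T 0] T by (auto simp: front_zero)
  then have "continuous_on {0..X T} (\<lambda>y. w\<^sub>0 (traj T y 0))"
    by (rule continuous_on_compose2[OF w0_cont foot_continuous[OF T]])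
  then show ?thesis
    by (rule continuous_on_eq) (use T in \<open>simp add: traj(2)\<close>)
qed

lemma mean_cluster_volume_eq: "mean_cluster_volume w T = 1 / w 0 T"
proof -
  have T: "0 \<le> T" using T_pos by simp
  let ?W = "\<lambda>y. w y T"
  have X: "0 < X T" by (rule front_pos) (use T in auto)
  have W_zero: "w x T = 0" if "X T \<le> x" for x
    by (rule w_beyond_front) (use that T in auto)
  have c_zero: "cluster_density w x T = 0" if "X T < x" for x
  proof -
    have "\<forall>\<^sub>F y in nhds x. y \<in> {X T<..}"
      using that by (intro eventually_nhds_in_open) auto
    then have "\<forall>\<^sub>F y in nhds x. 0 = ?W y"
      by eventually_elim (simp add: W_zero)
    then have "(?W has_real_derivative 0) (at x)"
      using DERIV_cong_ev[of x x "\<lambda>_. 0" ?W 0 0] by simp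
    then show ?thesis
      by (simp add: cluster_density_def DERIV_imp_deriv)
  qed
  have "(LBINT x:{0<..}. cluster_density w x T) = - w (X T) T - - w 0 T"
  proof (rule LBINT_nonneg_derivative[where a = "X T" and G = "\<lambda>x. - w x T"])
    show "((\<lambda>x. - w x T) has_real_derivative cluster_density w x T) (at x)"
      if "0 < x" "x < X T" for x
      unfolding cluster_density_def by (intro DERIV_minus w_differentiable that)
    show "continuous_on {0..X T} (\<lambda>x. - w x T)"
      by (intro continuous_intros w_continuous)
  qed (use X c_zero w_differentiable(2) in \<open>auto simp: cluster_density_def\<close>)
  then have number: "(LBINT x:{0<..}. cluster_density w x T) = w 0 T"
    by (simp add: W_zero)
  have W_int: "integral {0..X T} ?W = 1"
  proof -
    have eq: "(\<lambda>x. indicator {0..X T} x *\<^sub>R w x T) = (\<lambda>x. indicator {0..} x *\<^sub>R w x T)"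
      by (auto simp: indicator_def W_zero fun_eq_iff)
    then have "set_integrable lborel {0..X T} ?W" "(LBINT x:{0..X T}. w x T) = 1"
      using mass[OF T] by (simp_all add: set_integrable_def set_lebesgue_integral_def)
    then show ?thesis
      by (simp_all add: set_borel_integral_eq_integral(2)[symmetric])
  qed
  \<comment> \<open>Integration by parts: \<open>G\<close> is an antiderivative of \<open>x c(x,T)\<close>.\<close>
  define G where "G x = integral {0..x} ?W - x * w x T" for x
  have "(LBINT x:{0<..}. x * cluster_density w x T) = G (X T) - G 0"
  proof (rule LBINT_nonneg_derivative[where a = "X T" and G = G])
    show "(G has_real_derivative x * cluster_density w x T) (at x)" if x: "0 < x" "x < X T" for x
    proof -
      have "((\<lambda>x. integral {0..x} ?W) has_real_derivative w x T) (at x within {0..X T})"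
        by (rule integral_has_real_derivative[OF w_continuous]) (use x in auto)
      then have "((\<lambda>x. integral {0..x} ?W) has_real_derivative w x T) (at x)"
        using x by (simp add: at_within_Icc_at)
      from DERIV_diff[OF this DERIV_mult[OF DERIV_ident w_differentiable(1)[OF x]]]
      show ?thesis
        by (simp add: G_def[abs_def] cluster_density_def mult.commute)
    qed
    show "continuous_on {0..X T} G"
      unfolding G_def
      by (intro continuous_intros indefinite_integral_continuous_1 integrable_continuous_interval w_continuous)
  qed (use X c_zero w_differentiable(2) in \<open>auto simp: cluster_density_def mult_nonneg_nonpos\<close>)
  then have "(LBINT x:{0<..}. x * cluster_density w x T) = 1"
    by (simp add: G_def W_zero W_int)
  then show ?thesis
    by (simp add: mean_cluster_volume_def number)
qed

end

section \<open>Linear growth\<close>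

text \<open>Here \<open>t\<^sub>0 = 6 R x\<^sub>0 / (R - x\<^sub>0)\<close> is a time after which the largest volume \<open>X\<close> has slope at
  least \<open>1 / critical_ratio \<delta> - 1\<close>.  The first entry of the minimum, from \<open>R \<le> X\<close>, serves the times up
  to \<open>2 (t\<^sub>0 + 1)\<close>, the second one the later times; the last factor \<open>1 / 2\<close> comes from
  \<open>X / 2 \<le> \<Lambda>\<close>.\<close>

definition growth_constant :: "real \<Rightarrow> real \<Rightarrow> real \<Rightarrow> real" where
  "growth_constant R x\<^sub>0 \<delta> =
    min (R / (2 * (6 * R * x\<^sub>0 / (R - x\<^sub>0) + 1))) ((1 / critical_ratio \<delta> - 1) / 2) / 2"

lemma growth_constant_pos:
  assumes "0 \<le> x\<^sub>0" "x\<^sub>0 < R" "0 < \<delta>"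
  shows "0 < growth_constant R x\<^sub>0 \<delta>"
proof -
  have "0 \<le> 6 * R * x\<^sub>0 / (R - x\<^sub>0)"
    using assms by simp
  moreover have "0 < R / (2 * (t + 1))" if "0 \<le> t" for t
    using assms that by simp
  ultimately have "0 < R / (2 * (6 * R * x\<^sub>0 / (R - x\<^sub>0) + 1))"
    by blast
  moreover have "0 < (1 / critical_ratio \<delta> - 1) / 2"
    using critical_ratio_bounds[OF assms(3)] by simp
  ultimately show ?thesis
    by (simp add: growth_constant_def)
qed

lemma mean_cluster_volume_linear_growth:
  assumes u: "lsw_initial_data u" and P: "associated_law u P" and M: "Linf_norm P = ereal R"
    and beta: "is_beta_function u (ereal R) \<beta>"
    and le: "\<And>x. x \<in> beta_domain (ereal R) \<Longrightarrow> \<beta> x \<le> 1 / 33"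
    and x0: "0 \<le> x\<^sub>0" "x\<^sub>0 < R" and \<delta>: "0 < \<delta>"
    and ge: "\<And>x. x \<in> {x\<^sub>0..<R} \<Longrightarrow> \<delta> \<le> \<beta> x"
    and sol: "lsw_solution u w L" and T: "1 \<le> T"
  shows "growth_constant R x\<^sub>0 \<delta> * T \<le> mean_cluster_volume w T"
proof -
  obtain R' u' where R': "ereal R = ereal R'" "0 < R'"
    and pos': "\<And>x. x \<in> {0..<R'} \<Longrightarrow> 0 < u x"
    and zero': "\<And>x. R' \<le> x \<Longrightarrow> u x = 0"
    and du': "\<And>x. x \<in> {0..<R'} \<Longrightarrow> (u has_real_derivative u' x) (at x within {0..<R'})"
    and lower': "\<And>x. x \<in> {0..<R'} \<Longrightarrow> - u' x * ((1 - 1 / 33) * (R' - x)) \<le> 1 / 33 * u x"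
    and upper': "\<And>x. x \<in> {0..<R'} \<Longrightarrow> \<beta> x * u x \<le> - u' x * (R' - x)"
    using initial_data_logarithmic_derivative[OF u P M[symmetric] beta le] by auto
  have "R' = R" using R' by simp
  note R = R'(2)[unfolded this] and pos = pos'[unfolded this] and zero = zero'[unfolded this]
    and du = du'[unfolded this] and lower = lower'[unfolded this] and upper = upper'[unfolded this]
  have ratio_ge: "((R - y) / (R - x)) powr (1 / 32) * u x \<le> u y"
    if "0 \<le> x" "x \<le> y" "y \<le> R" "x < R" for x y
  \<comment> \<open>At \<open>y = R\<close> both sides vanish, as \<open>0 powr \<kappa> = 0\<close>.\<close>
  proof (cases "y = R")
    case False
    show ?thesis
    proof (rule ratio_powr_le[OF du])
      show "- u' z * (R - z) \<le> 1 / 32 * u z" if "z \<in> {0<..<R}" for z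
        using lower[of z] that by (simp add: algebra_simps)
    qed (use that False in auto)
  qed (simp add: zero)
  have ratio_le: "u y \<le> ((R - y) / (R - x)) powr \<delta> * u x"
    if "x\<^sub>0 \<le> x" "x \<le> y" "y \<le> R" "x < R" for x y
  proof (cases "y = R")
    case False
    show ?thesis
    proof (rule ratio_powr_ge)
      show "(u has_real_derivative u' z) (at z within {x\<^sub>0..<R})" if "z \<in> {x\<^sub>0..<R}" for z
        by (rule has_field_derivative_subset[OF du]) (use that x0 in auto)
      show "\<delta> * u z \<le> - u' z * (R - z)" if "z \<in> {x\<^sub>0<..<R}" for z
      proof -
        have "\<delta> * u z \<le> \<beta> z * u z"
          using pos[of z] ge[of z] that x0 by (intro mult_right_mono) auto
        then show ?thesis
          using upper[of z] that x0 by simp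
      qed
    qed (use that False in auto)
  qed (simp add: zero)
  have nonneg: "0 \<le> u x" if "0 \<le> x" for x
    using u that by (simp add: lsw_initial_data_def)
  have cont: "continuous_on {0..R} u"
    unfolding continuous_on_eq_continuous_within
  proof
    fix x assume x: "x \<in> {0..R}"
    show "continuous (at x within {0..R}) u"
    proof (cases "x = R")
      case False
      then have "at x within {0..R} = at x within {0..<R}"
        using x by (intro at_within_nhd[of _ "{..<R}"]) auto
      then show ?thesis
        using DERIV_continuous[OF du[of x]] x False by auto
    next
      case True
      have "\<forall>\<^sub>F z in nhds R. z \<in> {x\<^sub>0<..}"
        using x0 by (intro eventually_nhds_in_open) auto
      then have ev: "\<forall>\<^sub>F z in at R within {0..R}. x\<^sub>0 < z \<and> 0 \<le> z \<and> z \<le> R"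
        unfolding eventually_at_filter by eventually_elim auto
      have "((\<lambda>z. (R - z) / (R - x\<^sub>0)) \<longlongrightarrow> (R - R) / (R - x\<^sub>0)) (at R within {0..R})"
        using x0 by (intro tendsto_intros) auto
      then have "((\<lambda>z. ((R - z) / (R - x\<^sub>0)) powr \<delta>) \<longlongrightarrow> 0) (at R within {0..R})"
        using ev \<delta> x0 by (intro tendsto_zero_powrI[where b = \<delta>]) (auto elim: eventually_mono)
      then have lim: "((\<lambda>z. ((R - z) / (R - x\<^sub>0)) powr \<delta> * u x\<^sub>0) \<longlongrightarrow> 0) (at R within {0..R})"
        by (rule tendsto_mult_left_zero)
      have "(u \<longlongrightarrow> 0) (at R within {0..R})"
      proof (rule tendsto_sandwich[OF _ _ tendsto_const lim])
        show "\<forall>\<^sub>F z in at R within {0..R}. 0 \<le> u z"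
          using ev by eventually_elim (simp add: nonneg)
        show "\<forall>\<^sub>F z in at R within {0..R}. u z \<le> ((R - z) / (R - x\<^sub>0)) powr \<delta> * u x\<^sub>0"
          using ev by eventually_elim (use x0 in \<open>simp add: ratio_le\<close>)
      qed
      then show ?thesis
        by (simp add: True continuous_within zero)
    qed
  qed
  have T0: "0 \<le> T" using T by simp
  interpret lsw_compact u w L R
    using R sol pos zero u by unfold_locales (auto simp: lsw_initial_data_def monotone_on_def)
  obtain X where X: "lsw_characteristic L T (X T) X" "X 0 = R"
    using front_exists[OF T0] .
  interpret lsw_front u w L R T X
    using T0 X by unfold_locales
  interpret lsw_spread u w L R T X x\<^sub>0 \<delta>
    using ratio_ge ratio_le x0 \<delta> by unfold_locales auto
  interpret lsw_smooth u w L R T X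
  proof unfold_locales
    show "\<exists>d. (u has_real_derivative d) (at x)" if "0 < x" "x < R" for x
      using du[of x] at_within_interior[of x "{0..<R}"] that by auto
  qed (use cont T in auto)
  define t0 c where "t0 = 6 * R * x\<^sub>0 / (R - x\<^sub>0)" and "c = 1 / critical_ratio \<delta> - 1"
  have t0: "0 \<le> t0"
    using x0 R by (simp add: t0_def)
  have c: "0 < c"
    using critical_ratio_bounds[OF \<delta>] by (simp add: c_def)
  have C_eq: "2 * growth_constant R x\<^sub>0 \<delta> = min (R / (2 * (t0 + 1))) (c / 2)"
    by (simp add: growth_constant_def t0_def c_def)
  have "2 * growth_constant R x\<^sub>0 \<delta> * T \<le> X T"
  proof (cases "T \<le> 2 * (t0 + 1)")
    case True
    have "2 * growth_constant R x\<^sub>0 \<delta> * T \<le> R / (2 * (t0 + 1)) * T"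
      unfolding C_eq by (intro mult_right_mono min.cobounded1 T0)
    also have "\<dots> \<le> R / (2 * (t0 + 1)) * (2 * (t0 + 1))"
      using True R t0 by (intro mult_left_mono) auto
    also have "\<dots> = X 0"
      using t0 X by simp
    also have "\<dots> \<le> X T"
      using T0 by (intro front_mono) auto
    finally show ?thesis .
  next
    case False
    have "2 * growth_constant R x\<^sub>0 \<delta> * T \<le> c / 2 * T"
      unfolding C_eq by (intro mult_right_mono min.cobounded2 T0)
    also have "\<dots> = c * (T / 2)"
      by simp
    also have "\<dots> \<le> c * (T - t0)"
      using False c t0 by (intro mult_left_mono) auto
    also have "\<dots> \<le> X T"
      using front_ge_linear False t0 by (simp add: t0_def c_def)
    finally show ?thesis .
  qed
  then show ?thesis
    using front_le_mean[of T] T0 by (simp add: mean_cluster_volume_eq)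
qed

theorem proposition4p3:
  shows "\<exists>\<beta>max::real. 0 < \<beta>max \<and>
    (\<forall>(M::ereal) (\<beta>\<^sub>0::real \<Rightarrow> real). \<exists>C::real. 0 < C \<and>
      (\<forall>(w\<^sub>0::real \<Rightarrow> real) (P::real measure) (w::real \<Rightarrow> real \<Rightarrow> real) (L::real \<Rightarrow> real).
         lsw_initial_data w\<^sub>0 \<and>
         associated_law w\<^sub>0 P \<and>
         M = Linf_norm P \<and>
         is_beta_function w\<^sub>0 M \<beta>\<^sub>0 \<and>
         (SUP x\<in>beta_domain M. ereal (\<beta>\<^sub>0 x)) \<le> ereal \<beta>max \<and>
         0 < Liminf (at_left M) (\<lambda>x. ereal (\<beta>\<^sub>0 (real_of_ereal x))) \<and>
         lsw_solution w\<^sub>0 w L \<and>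
         L 0 = 1
         \<longrightarrow> (\<forall>T\<ge>1. C * T \<le> mean_cluster_volume w T)))"
proof (rule exI[of _ "1 / 33"], intro conjI allI)
  show "0 < (1 / 33 :: real)" by simp
next
  fix M :: ereal and \<beta> :: "real \<Rightarrow> real"
  let ?narrow = "(SUP x\<in>beta_domain M. ereal (\<beta> x)) \<le> ereal (1 / 33)"
  let ?spread = "0 < Liminf (at_left M) (\<lambda>x. ereal (\<beta> (real_of_ereal x)))"
  let ?Q = "\<lambda>C w\<^sub>0 P w L. lsw_initial_data w\<^sub>0 \<and> associated_law w\<^sub>0 P \<and> M = Linf_norm P \<and>
      is_beta_function w\<^sub>0 M \<beta> \<and> ?narrow \<and> ?spread \<and> lsw_solution w\<^sub>0 w L \<and> L 0 = 1
      \<longrightarrow> (\<forall>T\<ge>1. C * T \<le> mean_cluster_volume w T)"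
  have le: "\<beta> x \<le> 1 / 33" if ?narrow "x \<in> beta_domain M" for x
  proof -
    have "ereal (\<beta> x) \<le> (SUP x\<in>beta_domain M. ereal (\<beta> x))"
      using that(2) by (rule SUP_upper)
    also have "\<dots> \<le> ereal (1 / 33)"
      by (rule that(1))
    finally show ?thesis by simp
  qed
  show "\<exists>C. 0 < C \<and> (\<forall>w\<^sub>0 P w L. ?Q C w\<^sub>0 P w L)"
  proof (cases "?narrow \<and> ?spread \<and> (\<exists>R. M = ereal R \<and> 0 < R)")
    case True
    then obtain R where R: "M = ereal R" "0 < R"
      by blast
    obtain \<delta> where \<delta>: "0 < ereal \<delta>" "ereal \<delta> < Liminf (at_left M) (\<lambda>x. ereal (\<beta> (real_of_ereal x)))"
      using True ereal_dense2 by blast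
    have "0 < M" using R by simp
    from less_LiminfD[OF \<delta>(2)] obtain b where b: "b < M"
      "\<And>y. b < y \<Longrightarrow> y < M \<Longrightarrow> ereal \<delta> < ereal (\<beta> (real_of_ereal y))"
      unfolding eventually_at_left[OF \<open>0 < M\<close>] by blast
    obtain x\<^sub>0 where x0: "max 0 b < ereal x\<^sub>0" "ereal x\<^sub>0 < M"
      using ereal_dense2[of "max 0 b" M] b(1) \<open>0 < M\<close> by auto
    have ge: "\<delta> \<le> \<beta> x" if "x \<in> {x\<^sub>0..<R}" for x
    proof -
      have "b < ereal x"
        using x0(1) that by (auto intro: less_le_trans)
      then show ?thesis
        using b(2)[of "ereal x"] that R by simp
    qed
    \<comment> \<open>\<open>R\<close>, \<open>x\<^sub>0\<close> and \<open>\<delta>\<close> were chosen from \<open>M\<close> and \<open>\<beta>\<close> alone, and so is the constant.\<close>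
    have "?Q (growth_constant R x\<^sub>0 \<delta>) w\<^sub>0 P w L" for w\<^sub>0 P w L
      using mean_cluster_volume_linear_growth[of w\<^sub>0 P R \<beta> x\<^sub>0 \<delta> w L] le True ge x0 \<delta>(1) R by auto
    then show ?thesis
      using growth_constant_pos[of x\<^sub>0 R \<delta>] x0 \<delta>(1) R by auto
  next
    case False
    \<comment> \<open>The hypotheses are then inconsistent: a small beta function forces a finite \<open>M\<close>.\<close>
    have "\<not> (lsw_initial_data w\<^sub>0 \<and> associated_law w\<^sub>0 P \<and> M = Linf_norm P \<and>
        is_beta_function w\<^sub>0 M \<beta> \<and> ?narrow \<and> ?spread)" for w\<^sub>0 P
    proof
      assume H: "lsw_initial_data w\<^sub>0 \<and> associated_law w\<^sub>0 P \<and> M = Linf_norm P \<and>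
        is_beta_function w\<^sub>0 M \<beta> \<and> ?narrow \<and> ?spread"
      obtain R where "M = ereal R" "0 < R"
        by (rule initial_data_logarithmic_derivative[of w\<^sub>0 P M \<beta> "1 / 33"]) (use H le in auto)
      with False H show False by blast
    qed
    then show ?thesis
      by (intro exI[of _ 1]) auto
  qed
qed

end
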